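(* Let $g\ge 0$, $n^+,n^-\ge 1$ be integers with $2g-2+n^++n^->0$. The function $(L^+,L^-)\mapsto V_{g,n^+,n^-}(L^+|L^-)$ on $\Lambda_{n^+,n^-}$ is a continuous, homogeneous, piecewise polynomial function of degree $4g-3+n^++n^-$.
   Context: A ribbon graph $R$ is a finite set $XR$ (half-edges) with permutations $s_0,s_1,s_2$ of $XR$ such that $s_1$ is an involution without fixed points and $s_2s_1s_0=\mathrm{id}$. The sets $X_0R,X_1R,X_2R$ of orbits of $s_0,s_1,s_2$ are the vertices, edges and boundary components of $R$; $[e]_i$ is the orbit of $e\in XR$ under $s_i$; the degree of a vertex is its number of half-edges. $R$ is connected if $\langle s_0,s_1,s_2\rangle$ acts transitively on $XR$, and then its genus $g$ is defined by $2-2g=\#X_0R-\#X_1R+\#X_2R$. A direction is a map $\epsilon:XR\to\{\pm1\}$ with $\epsilon\circ s_2=\epsilon$ and $\epsilon\circ s_1=-\epsilon$; a directed ribbon graph is $R^\circ=(R,\epsilon)$. As $\epsilon$ is constant on boundary components, these split into positive and negative ones. $R^\circ$ is of type $(g,n^+,n^-)$ if it is connected of genus $g$ with $n^+$ positive boundary components labelled $1,\dots,n^+$ and $n^-$ negative ones labelled $1,\dots,n^-$; isomorphisms are bijections of half-edges commuting with all $s_i$ and preserving $\epsilon$ and the labels, and $\mathrm{Aut}(R^\circ)$ is the corresponding automorphism group. A metric is a map $m:X_1R\to\mathbb R_{>0}$; the length of $\beta\in X_2R$ is $\sum_{e\in XR,\,[e]_2=\beta}m_{[e]_1}$. Let $\Lambda_{n^+,n^-}=\{(L^+,L^-)\in\mathbb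 R_{>0}^{n^+}\times\mathbb R_{>0}^{n^-}:\sum_iL_i^+=\sum_jL_j^-\}$. For $L=(L^+,L^-)\in\Lambda_{n^+,n^-}$, $\mathrm{Met}(R^\circ,L)$ is the set of metrics whose positive (negative) boundary lengths are $L^+$ (resp. $L^-$). It lies in an affine space directed by the kernel $K_R\subset\mathbb R^{X_1R}$ of the linear boundary-length map $\mathbb R^{X_1R}\to\mathbb R^{X_2R}$, and it carries the Lebesgue measure for which the lattice $K_R\cap\mathbb Z^{X_1R}$ has covolume one (counting measure if $K_R=0$). The volume of the moduli space is $$V_{g,n^+,n^-}(L^+|L^-)=\sum_{R^\circ}\frac{1}{\#\mathrm{Aut}(R^\circ)}\mathrm{vol}(\mathrm{Met}(R^\circ,L)),$$ the (finite) sum being over isomorphism classes of directed ribbon graphs of type $(g,n^+,n^-)$ all of whose vertices have degree $4$. Piecewise polynomial means: there is a finite collection of linear hyperplanes of the ambient linear space $\{\sum L_i^+=\sum L_j^-\}$ such that the function agrees with a polynomial on each connected component of the complement of these hyperplanes in $\Lambda_{n^+,n^-}$. *)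

theory Defs
  imports "HOL-Analysis.Analysis" "HOL-Combinatorics.Orbits"
begin

section \<open>Ribbon graphs\<close>

record 'h ribbon_graph =
  half_edges :: "'h set"
  s0 :: "'h \<Rightarrow> 'h"
  s1 :: "'h \<Rightarrow> 'h"
  s2 :: "'h \<Rightarrow> 'h"

definition is_ribbon_graph :: "('h, 'z) ribbon_graph_scheme \<Rightarrow> bool" where
  "is_ribbon_graph R \<longleftrightarrow>
     finite (half_edges R) \<and>
     s0 R permutes half_edges R \<and> s1 R permutes half_edges R \<and> s2 R permutes half_edges R \<and>
     (\<forall>e\<in>half_edges R. s1 R (s1 R e) = e \<and> s1 R e \<noteq> e) \<and>
     s2 R \<circ> s1 R \<circ> s0 R = id"

definition vertices :: "('h, 'z) ribbon_graph_scheme \<Rightarrow> 'h set set" where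
  "vertices R = orbit (s0 R) ` half_edges R"

definition edges :: "('h, 'z) ribbon_graph_scheme \<Rightarrow> 'h set set" where
  "edges R = orbit (s1 R) ` half_edges R"

definition boundaries :: "('h, 'z) ribbon_graph_scheme \<Rightarrow> 'h set set" where
  "boundaries R = orbit (s2 R) ` half_edges R"

inductive_set perm_group :: "('h, 'z) ribbon_graph_scheme \<Rightarrow> ('h \<Rightarrow> 'h) set"
  for R :: "('h, 'z) ribbon_graph_scheme" where
  one: "id \<in> perm_group R"
| mult: "f \<in> perm_group R \<Longrightarrow> s \<in> {s0 R, s1 R, s2 R} \<Longrightarrow> s \<circ> f \<in> perm_group R"
| mult_inv: "f \<in> perm_group R \<Longrightarrow> s \<in> {s0 R, s1 R, s2 R} \<Longrightarrow> inv s \<circ> f \<in> perm_group R"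

definition connected_graph :: "('h, 'z) ribbon_graph_scheme \<Rightarrow> bool" where
  "connected_graph R \<longleftrightarrow>
     half_edges R \<noteq> {} \<and>
     (\<forall>x\<in>half_edges R. \<forall>y\<in>half_edges R. \<exists>f\<in>perm_group R. f x = y)"

definition has_genus :: "('h, 'z) ribbon_graph_scheme \<Rightarrow> nat \<Rightarrow> bool" where
  "has_genus R g \<longleftrightarrow>
     2 - 2 * int g = int (card (vertices R)) - int (card (edges R)) + int (card (boundaries R))"

definition four_valent :: "('h, 'z) ribbon_graph_scheme \<Rightarrow> bool" where
  "four_valent R \<longleftrightarrow> (\<forall>v\<in>vertices R. card v = 4)"


section \<open>Directed ribbon graphs with labelled boundary components\<close>

text \<open>
  The positive and negative boundary components are labelled by the finite types \<open>'p\<close> and \<open>'n\<close>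
  instead of \<open>{1..n\<^sup>+}\<close> and \<open>{1..n\<^sup>-}\<close>; thus \<open>n\<^sup>+ = CARD('p)\<close> and \<open>n\<^sup>- = CARD('n)\<close>.
\<close>

record ('h, 'p, 'n) directed_ribbon_graph = "'h ribbon_graph" +
  dir :: "'h \<Rightarrow> int"
  pos_label :: "'h set \<Rightarrow> 'p"
  neg_label :: "'h set \<Rightarrow> 'n"

definition is_direction :: "('h, 'z) ribbon_graph_scheme \<Rightarrow> ('h \<Rightarrow> int) \<Rightarrow> bool" where
  "is_direction R \<epsilon> \<longleftrightarrow>
     (\<forall>e\<in>half_edges R. \<epsilon> e \<in> {1, -1} \<and> \<epsilon> (s2 R e) = \<epsilon> e \<and> \<epsilon> (s1 R e) = - \<epsilon> e)"

definition pos_boundaries :: "('h, 'p, 'n) directed_ribbon_graph \<Rightarrow> 'h set set" where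
  "pos_boundaries R = {\<beta> \<in> boundaries R. \<forall>e\<in>\<beta>. dir R e = 1}"

definition neg_boundaries :: "('h, 'p, 'n) directed_ribbon_graph \<Rightarrow> 'h set set" where
  "neg_boundaries R = {\<beta> \<in> boundaries R. \<forall>e\<in>\<beta>. dir R e = -1}"

definition has_type :: "('h, 'p::finite, 'n::finite) directed_ribbon_graph \<Rightarrow> nat \<Rightarrow> bool" where
  "has_type R g \<longleftrightarrow>
     is_ribbon_graph R \<and> is_direction R (dir R) \<and> connected_graph R \<and> has_genus R g \<and>
     bij_betw (pos_label R) (pos_boundaries R) UNIV \<and>
     bij_betw (neg_label R) (neg_boundaries R) UNIV"

definition is_iso ::
  "('h, 'p, 'n) directed_ribbon_graph \<Rightarrow> ('k, 'p, 'n) directed_ribbon_graph \<Rightarrow> ('h \<Rightarrow> 'k) \<Rightarrow> bool"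
where
  "is_iso R S f \<longleftrightarrow>
     bij_betw f (half_edges R) (half_edges S) \<and>
     (\<forall>e\<in>half_edges R. f (s0 R e) = s0 S (f e) \<and> f (s1 R e) = s1 S (f e) \<and>
                        f (s2 R e) = s2 S (f e) \<and> dir S (f e) = dir R e) \<and>
     (\<forall>\<beta>\<in>pos_boundaries R. pos_label S (f ` \<beta>) = pos_label R \<beta>) \<and>
     (\<forall>\<beta>\<in>neg_boundaries R. neg_label S (f ` \<beta>) = neg_label R \<beta>)"

text \<open>
  Automorphisms are taken to be the identity outside the half-edges, so that each automorphism is
  counted once.
\<close>

definition automorphisms :: "('h, 'p, 'n) directed_ribbon_graph \<Rightarrow> ('h \<Rightarrow> 'h) set" where
  "automorphisms R = {f. f permutes half_edges R \<and> is_iso R R f}"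


section \<open>Metrics\<close>

text \<open>
  Elements of \<open>\<real>\<^sup>E\<close> are represented by the extensional functions in \<open>E \<rightarrow>\<^sub>E UNIV\<close>.
\<close>

definition boundary_length ::
  "('h, 'z) ribbon_graph_scheme \<Rightarrow> ('h set \<Rightarrow> real) \<Rightarrow> 'h set \<Rightarrow> real" where
  "boundary_length R m \<beta> = (\<Sum>e | e \<in> half_edges R \<and> orbit (s2 R) e = \<beta>. m (orbit (s1 R) e))"

definition boundary_kernel :: "('h, 'z) ribbon_graph_scheme \<Rightarrow> ('h set \<Rightarrow> real) set" where
  "boundary_kernel R = {v \<in> edges R \<rightarrow>\<^sub>E UNIV. \<forall>\<beta>\<in>boundaries R. boundary_length R v \<beta> = 0}"

definition Met ::
  "('h, 'p::finite, 'n::finite) directed_ribbon_graph \<Rightarrow> (real ^ 'p) \<times> (real ^ 'n)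
     \<Rightarrow> ('h set \<Rightarrow> real) set" where
  "Met R L = {m \<in> edges R \<rightarrow>\<^sub>E {0<..}.
     (\<forall>\<beta>\<in>pos_boundaries R. boundary_length R m \<beta> = fst L $ pos_label R \<beta>) \<and>
     (\<forall>\<beta>\<in>neg_boundaries R. boundary_length R m \<beta> = snd L $ neg_label R \<beta>)}"


section \<open>Normalised Lebesgue measure on a translate of a rational subspace\<close>

text \<open>
  \<open>lattice_basis E K k b\<close>: the vectors \<open>b 0, \<dots>, b (k - 1)\<close> form a basis of the subspace \<open>K\<close> of
  \<open>\<real>\<^sup>E\<close> and a \<open>\<int>\<close>-basis of the lattice of integer points of \<open>K\<close>.
\<close>

definition lin_comb :: "'a set \<Rightarrow> nat \<Rightarrow> (nat \<Rightarrow> 'a \<Rightarrow> real) \<Rightarrow> (nat \<Rightarrow> real) \<Rightarrow> 'a \<Rightarrow> real" where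
  "lin_comb E k b t = (\<lambda>e\<in>E. \<Sum>i<k. t i * b i e)"

definition lattice_basis ::
  "'a set \<Rightarrow> ('a \<Rightarrow> real) set \<Rightarrow> nat \<Rightarrow> (nat \<Rightarrow> 'a \<Rightarrow> real) \<Rightarrow> bool" where
  "lattice_basis E K k b \<longleftrightarrow>
     bij_betw (lin_comb E k b) ({..<k} \<rightarrow>\<^sub>E UNIV) K \<and>
     lin_comb E k b ` ({..<k} \<rightarrow>\<^sub>E \<int>) = K \<inter> (E \<rightarrow>\<^sub>E \<int>)"

text \<open>
  For \<open>A\<close> contained in a translate of \<open>K\<close>, \<open>lattice_volume E K A\<close> is the volume of \<open>A\<close> for the
  Lebesgue measure giving covolume one to the integer points of \<open>K\<close>: choose a lattice basis \<open>b\<close>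
  and a base point \<open>a\<close> in \<open>A\<close>, and measure \<open>A\<close> in the coordinates \<open>t \<mapsto> a + \<Sum>i<k. t i * b i\<close>.
  Neither choice affects the value, as lattice bases differ by unimodular matrices and the
  measure is translation invariant. For \<open>k = 0\<close> the product measure is the unit mass on the
  one-point space, which gives the counting measure; for \<open>A = {}\<close> the value is \<open>0\<close> whatever the
  base point.
\<close>

definition lattice_volume :: "'a set \<Rightarrow> ('a \<Rightarrow> real) set \<Rightarrow> ('a \<Rightarrow> real) set \<Rightarrow> real" where
  "lattice_volume E K A =
     (let (k, b) = (SOME (k, b). lattice_basis E K k b);
          a = (SOME a. a \<in> A)
      in measure (PiM {..<k} (\<lambda>_. lborel))
           {t \<in> {..<k} \<rightarrow>\<^sub>E UNIV. (\<lambda>e\<in>E. a e + lin_comb E k b t e) \<in> A})"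


section \<open>The volume function\<close>

definition length_domain :: "((real ^ 'p::finite) \<times> (real ^ 'n::finite)) set" where
  "length_domain = {L. (\<forall>i. fst L $ i > 0) \<and> (\<forall>j. snd L $ j > 0) \<and>
                       (\<Sum>i\<in>UNIV. fst L $ i) = (\<Sum>j\<in>UNIV. snd L $ j)}"

definition length_space :: "((real ^ 'p::finite) \<times> (real ^ 'n::finite)) set" where
  "length_space = {L. (\<Sum>i\<in>UNIV. fst L $ i) = (\<Sum>j\<in>UNIV. snd L $ j)}"

text \<open>
  Every finite ribbon graph is isomorphic to one whose half-edges are natural numbers, so the
  isomorphism classes can be taken among those.
\<close>

definition four_valent_graphs ::
  "nat \<Rightarrow> (nat, 'p::finite, 'n::finite) directed_ribbon_graph set" where
  "four_valent_graphs g = {R. has_type R g \<and> four_valent R}"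

definition iso_rel :: "nat \<Rightarrow> (nat, 'p::finite, 'n::finite) directed_ribbon_graph rel" where
  "iso_rel g = {(R, S). R \<in> four_valent_graphs g \<and> S \<in> four_valent_graphs g \<and> (\<exists>f. is_iso R S f)}"

definition moduli_volume ::
  "nat \<Rightarrow> (real ^ 'p::finite) \<times> (real ^ 'n::finite) \<Rightarrow> real" where
  "moduli_volume g L =
     (\<Sum>C \<in> (four_valent_graphs g :: (nat, 'p, 'n) directed_ribbon_graph set) // iso_rel g.
        let R = (SOME R. R \<in> C)
        in 1 / real (card (automorphisms R)) *
             lattice_volume (edges R) (boundary_kernel R) (Met R L))"


section \<open>Homogeneous piecewise polynomial functions\<close>

definition homogeneous_on :: "'a::real_vector set \<Rightarrow> nat \<Rightarrow> ('a \<Rightarrow> real) \<Rightarrow> bool" where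
  "homogeneous_on S d f \<longleftrightarrow> (\<forall>x\<in>S. \<forall>t>0. f (t *\<^sub>R x) = t ^ d * f x)"

definition hyperplane_in :: "'a::euclidean_space set \<Rightarrow> 'a set \<Rightarrow> bool" where
  "hyperplane_in H W \<longleftrightarrow> subspace W \<and> W \<subseteq> H \<and> dim W + 1 = dim H"

text \<open>
  A polynomial function \<open>p\<close> with \<open>p (t *\<^sub>R x) = t ^ d * p x\<close> for all \<open>t\<close> and \<open>x\<close> is the same as a
  homogeneous polynomial of degree \<open>d\<close>; as usual, the zero polynomial is one of these.
\<close>

definition homogeneous_polynomial :: "nat \<Rightarrow> ('a::euclidean_space \<Rightarrow> real) \<Rightarrow> bool" where
  "homogeneous_polynomial d p \<longleftrightarrow>
     real_polynomial_function p \<and> (\<forall>t x. p (t *\<^sub>R x) = t ^ d * p x)"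

definition piecewise_homogeneous_polynomial_on ::
  "'a::euclidean_space set \<Rightarrow> 'a set \<Rightarrow> nat \<Rightarrow> ('a \<Rightarrow> real) \<Rightarrow> bool" where
  "piecewise_homogeneous_polynomial_on S H d f \<longleftrightarrow>
     (\<exists>\<W>. finite \<W> \<and> (\<forall>W\<in>\<W>. hyperplane_in H W) \<and>
          (\<forall>C\<in>components (S - \<Union>\<W>). \<exists>p. homogeneous_polynomial d p \<and> (\<forall>x\<in>C. f x = p x)))"

end

(*
  A metric on R is a positive flow on the bipartite multigraph whose nodes are the boundary
  components and whose edges are the edges of R.  Solving the flow equations along a spanning tree T
  of this multigraph gives a section a(L) of the boundary length map which is linear in L, and
  integral coordinates on K_R indexed by the edges outside T.  The number of these is
  #edges - #boundaries + 1 = 4g - 3 + n^+ + n^-.  Hence vol(Met(R, L)) is the Lebesgue measure of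

    { t in R^k : a_e(L) + sum_i t_i b_i(e) > 0 for all edges e },   k = 4g - 3 + n^+ + n^-,

  for a fixed lattice basis b.  Piecewise homogeneous polynomials are represented as sums of
  homogeneous polynomials in (L, t) cut off by conditions phi(L, t) > 0 with phi a linear form.
  Integrating out one variable over an interval with linear ends stays in this class and raises the
  degree by one, as a condition on s of the form c s + psi > 0 moves one end of the interval; so k
  integrations of the indicator function give degree k.

  Continuity in L follows by dominated convergence, since the conditions change only across the
  hyperplanes a_e(L) + sum_i t_i b_i(e) = 0, which are null sets unless b_i(e) = 0 for all i.  In that
  case the alternating sum of the half-edges around a vertex of e, which is an element of K_R, forces e
  to be a loop bounding a boundary component alone, and a_e(L) is the length of this component.
*)

theory Submission
  imports Defs
begin

section \<open>Integration of piecewise homogeneous polynomials\<close>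

text \<open>Here \<open>x\<close> is a parameter, later the vector of boundary lengths, and
  \<open>t\<close> holds the integration variables. As \<open>t\<close> is a total function, a
  single variable can be split off by writing \<open>t(n := s)\<close>, without a change of
  type.\<close>

definition lform :: "nat \<Rightarrow> ('a::real_vector \<Rightarrow> (nat \<Rightarrow> real) \<Rightarrow> real) \<Rightarrow> bool" where
  "lform n \<phi> \<longleftrightarrow> (\<exists>l c. linear l \<and> \<phi> = (\<lambda>x t. l x + (\<Sum>i<n. c i * t i)))"

text \<open>Sums of products of \<open>d\<close> linear forms, up to constants. This describes the
  homogeneous polynomials of degree \<open>d\<close> without a basis of the parameter space.\<close>

inductive hpoly :: "nat \<Rightarrow> nat \<Rightarrow> ('a::real_vector \<Rightarrow> (nat \<Rightarrow> real) \<Rightarrow> real) \<Rightarrow> bool" for n where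
  const: "hpoly n 0 (\<lambda>x t. c)"
| add: "hpoly n d f \<Longrightarrow> hpoly n d g \<Longrightarrow> hpoly n d (\<lambda>x t. f x t + g x t)"
| mult: "lform n \<phi> \<Longrightarrow> hpoly n d f \<Longrightarrow> hpoly n (Suc d) (\<lambda>x t. \<phi> x t * f x t)"

text \<open>Only strict conditions are primitive, and no fixed subdivision into cells is carried
  along. Members may jump across the hyperplanes, so continuity of the volume is a separate
  matter.\<close>

inductive hpw :: "nat \<Rightarrow> nat \<Rightarrow> ('a::real_vector \<Rightarrow> (nat \<Rightarrow> real) \<Rightarrow> real) \<Rightarrow> bool" for n where
  poly: "hpoly n d f \<Longrightarrow> hpw n d f"
| add: "hpw n d f \<Longrightarrow> hpw n d g \<Longrightarrow> hpw n d (\<lambda>x t. f x t + g x t)"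
| restrict: "lform n \<phi> \<Longrightarrow> hpw n d f \<Longrightarrow> hpw n d (\<lambda>x t. if \<phi> x t > 0 then f x t else 0)"

section \<open>Algebra of linear forms and piecewise homogeneous functions\<close>

lemma lform_linear: "linear l \<Longrightarrow> lform n (\<lambda>x t. l x)"
  unfolding lform_def by (rule exI[of _ l], rule exI[of _ "\<lambda>_. 0"]) simp

lemma lform_scale:
  assumes "lform n \<phi>" shows "lform n (\<lambda>x t. r * \<phi> x t)"
proof -
  from assms obtain l c where lc: "linear l" "\<phi> = (\<lambda>x t. l x + (\<Sum>i<n. c i * t i))"
    unfolding lform_def by blast
  have "linear (\<lambda>x. r * l x)"
    using linear_compose[OF lc(1), of "\<lambda>y. r * y"] by (simp add: o_def linear_iff algebra_simps)
  moreover have "(\<lambda>x t. r * \<phi> x t) = (\<lambda>x t. r * l x + (\<Sum>i<n. (r * c i) * t i))"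
    by (simp add: lc(2) algebra_simps sum_distrib_left)
  ultimately show ?thesis unfolding lform_def by (intro exI[of _ "\<lambda>x. r * l x"] exI[of _ "\<lambda>i. r * c i"]) simp
qed

lemma lform_add:
  assumes "lform n \<phi>" "lform n \<psi>" shows "lform n (\<lambda>x t. \<phi> x t + \<psi> x t)"
proof -
  from assms obtain l c l' c' where lc: "linear l" "\<phi> = (\<lambda>x t. l x + (\<Sum>i<n. c i * t i))"
    "linear l'" "\<psi> = (\<lambda>x t. l' x + (\<Sum>i<n. c' i * t i))"
    unfolding lform_def by blast
  show ?thesis unfolding lform_def
    by (intro exI[of _ "\<lambda>x. l x + l' x"] exI[of _ "\<lambda>i. c i + c' i"])
      (auto simp: lc linear_compose_add algebra_simps sum.distrib)
qed

lemma lform_diff: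
  assumes "lform n \<phi>" "lform n \<psi>" shows "lform n (\<lambda>x t. \<phi> x t - \<psi> x t)"
  using lform_add[OF assms(1) lform_scale[OF assms(2), of "-1"]] by simp

text \<open>Isolating the coefficient of the last variable turns a condition on
  \<open>\<phi>\<close> into a half-line of values \<open>s\<close>, whose end is a linear form in
  the other variables.\<close>

lemma lform_SucE:
  assumes "lform (Suc n) \<phi>"
  obtains \<psi> c where "lform n \<psi>" "\<And>x t s. \<phi> x (t(n := s)) = \<psi> x t + c * s"
proof -
  from assms obtain l c where lc: "linear l" "\<phi> = (\<lambda>x t. l x + (\<Sum>i<Suc n. c i * t i))"
    unfolding lform_def by blast
  show ?thesis
    by (rule that[of "\<lambda>x t. l x + (\<Sum>i<n. c i * t i)" "c n"]) (use lc in \<open>auto simp: lform_def\<close>)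
qed

lemma hpoly_scale: "hpoly n d f \<Longrightarrow> hpoly n d (\<lambda>x t. r * f x t)"
proof (induction rule: hpoly.induct)
  case (mult \<phi> d f)
  show ?case using hpoly.mult[OF mult(1) mult(3)] by (simp add: mult.left_commute)
qed (auto intro: hpoly.intros simp: distrib_left)

lemma hpoly_mult: "hpoly n d f \<Longrightarrow> hpoly n e g \<Longrightarrow> hpoly n (d + e) (\<lambda>x t. f x t * g x t)"
proof (induction rule: hpoly.induct)
  case (const c)
  then show ?case by (simp add: hpoly_scale)
next
  case (add d f g')
  then show ?case using hpoly.add by (fastforce simp: distrib_right)
next
  case (mult \<phi> d f)
  then show ?case using hpoly.mult[OF mult(1) mult(3)] by (simp add: mult.assoc)
qed

lemma hpoly_lform_power:
  assumes "lform n \<phi>" shows "hpoly n j (\<lambda>x t. \<phi> x t ^ j)"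
  by (induction j) (auto intro: hpoly.const hpoly.mult[OF assms])

lemma hpoly_zero: "hpoly n d (\<lambda>x t. 0)"
proof (induction d)
  case (Suc d)
  have "lform n (\<lambda>x t. 0)" by (rule lform_linear) (simp add: linear_iff)
  from hpoly.mult[OF this Suc] show ?case by simp
qed (rule hpoly.const)

lemma hpw_scale: "hpw n d f \<Longrightarrow> hpw n d (\<lambda>x t. r * f x t)"
proof (induction rule: hpw.induct)
  case (restrict \<phi> d f)
  have "(\<lambda>x t. r * (if \<phi> x t > 0 then f x t else 0)) = (\<lambda>x t. if \<phi> x t > 0 then r * f x t else 0)"
    by (simp add: fun_eq_iff)
  then show ?case using hpw.restrict[OF restrict(1) restrict(3)] by simp
qed (auto intro: hpw.intros hpoly_scale simp: distrib_left)

text \<open>The weak condition is the complement of the strict one, so the cut-off function is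
  subtracted from \<open>f\<close>. Both kinds together allow a choice between two ends of an
  interval.\<close>

lemma hpw_restrict_le:
  assumes "lform n \<phi>" "hpw n d f" shows "hpw n d (\<lambda>x t. if \<phi> x t \<le> 0 then f x t else 0)"
proof -
  have "(\<lambda>x t. if \<phi> x t \<le> 0 then f x t else 0)
      = (\<lambda>x t. f x t + (-1) * (if \<phi> x t > 0 then f x t else 0))"
    by (auto simp: fun_eq_iff)
  then show ?thesis using hpw.add[OF assms(2) hpw_scale[OF hpw.restrict[OF assms], of "-1"]] by simp
qed

lemma hpw_sum: "(\<And>i. i \<in> I \<Longrightarrow> hpw n d (f i)) \<Longrightarrow> hpw n d (\<lambda>x t. \<Sum>i\<in>I. f i x t)"
  by (induction I rule: infinite_finite_induct) (auto intro: hpw.intros hpoly_zero)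

text \<open>The functions \<open>F x t s\<close> which are homogeneous polynomials in \<open>x\<close>, \<open>t 0, \<dots>, t (n - 1)\<close>, \<open>s\<close>,
  written as polynomials in \<open>s\<close>.\<close>

inductive hpoly_in :: "nat \<Rightarrow> nat \<Rightarrow> ('a::real_vector \<Rightarrow> (nat \<Rightarrow> real) \<Rightarrow> real \<Rightarrow> real) \<Rightarrow> bool" for n where
  monom: "hpoly n i q \<Longrightarrow> hpoly_in n (i + j) (\<lambda>x t s. q x t * s ^ j)"
| add: "hpoly_in n d F \<Longrightarrow> hpoly_in n d G \<Longrightarrow> hpoly_in n d (\<lambda>x t s. F x t s + G x t s)"

lemma hpoly_in_mult:
  assumes "hpoly_in n d F" "lform n \<psi>"
  shows "hpoly_in n (Suc d) (\<lambda>x t s. (\<psi> x t + c * s) * F x t s)"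
  using assms(1)
proof (induction rule: hpoly_in.induct)
  case (monom i q j)
  have "hpoly_in n (Suc i + j) (\<lambda>x t s. (\<psi> x t * q x t) * s ^ j)"
    by (intro hpoly_in.monom hpoly.mult assms monom)
  moreover have "hpoly_in n (i + Suc j) (\<lambda>x t s. (c * q x t) * s ^ Suc j)"
    by (intro hpoly_in.monom hpoly_scale monom)
  ultimately have "hpoly_in n (Suc (i + j)) (\<lambda>x t s. (\<psi> x t * q x t) * s ^ j + (c * q x t) * s ^ Suc j)"
    by (intro hpoly_in.add) simp_all
  then show ?case by (simp add: algebra_simps)
next
  case (add d F G)
  from hpoly_in.add[OF add(3,4)] show ?case by (simp add: algebra_simps)
qed

lemma hpoly_Suc_hpoly_in:
  "hpoly (Suc n) d p \<Longrightarrow> hpoly_in n d (\<lambda>x t s. p x (t(n := s)))"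
proof (induction rule: hpoly.induct)
  case (const c)
  show ?case using hpoly_in.monom[OF hpoly.const[of n c], of 0] by simp
next
  case (add d f g)
  then show ?case by (intro hpoly_in.add)
next
  case (mult \<phi> d f)
  from mult(1) obtain \<psi> c where "lform n \<psi>" "\<And>x t s. \<phi> x (t(n := s)) = \<psi> x t + c * s"
    by (rule lform_SucE) blast
  then show ?case using hpoly_in_mult[OF mult(3)] by (simp del: fun_upd_apply)
qed

section \<open>Integration of one variable between linear ends\<close>

abbreviation integral_between :: "real \<Rightarrow> real \<Rightarrow> (real \<Rightarrow> real) \<Rightarrow> real" where
  "integral_between l h f \<equiv> (LINT s:{l<..<h}|lborel. f s)"

lemma hpoly_in_continuous: "hpoly_in n d F \<Longrightarrow> continuous_on A (F x t)"
  by (induction rule: hpoly_in.induct) (auto intro!: continuous_intros)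

lemma set_integrable_open_interval:
  fixes f :: "real \<Rightarrow> real"
  assumes "continuous_on UNIV f"
  shows "set_integrable lborel {a<..<b} f"
  by (rule set_integrable_subset[OF borel_integrable_atLeastAtMost'[of a b]])
    (use assms in \<open>auto intro: continuous_on_subset\<close>)

text \<open>In contrast to the oriented integral, reversed ends give zero, which is what a volume
  requires.\<close>

lemma integral_between_empty: "\<not> l < h \<Longrightarrow> integral_between l h f = 0"
  by (simp add: set_lebesgue_integral_def)

lemma integral_between_power:
  assumes "l < h"
  shows "integral_between l h (\<lambda>s. s ^ j) = (h ^ Suc j - l ^ Suc j) / Suc j"
proof -
  have "integral_between l h (\<lambda>s. s ^ j) = (LBINT s. s ^ j * indicator {l..h} s)"
    unfolding set_lebesgue_integral_def
  proof (rule integral_cong_AE)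
    show "AE s in lborel. indicat_real {l<..<h} s *\<^sub>R s ^ j = s ^ j * indicat_real {l..h} s"
      using AE_lborel_singleton[of l] AE_lborel_singleton[of h] by eventually_elim (auto simp: indicator_def)
  qed auto
  also have "\<dots> = (h ^ Suc j - l ^ Suc j) / Suc j"
    using assms by (intro integral_power) simp
  finally show ?thesis .
qed

text \<open>The antiderivative of \<open>s ^ j\<close> has degree \<open>j + 1\<close>, and it is
  evaluated at linear ends, so the total degree grows by one. The cut-off by
  \<open>h x t - l x t > 0\<close> accounts for empty intervals.\<close>

lemma hpw_integral_hpoly_in:
  assumes "hpoly_in n d F" "lform n l" "lform n h"
  shows "hpw n (Suc d) (\<lambda>x t. integral_between (l x t) (h x t) (F x t))"
  using assms(1)
proof (induction rule: hpoly_in.induct)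
  case (monom i q j)
  let ?P = "\<lambda>\<rho>. hpoly n (i + Suc j) (\<lambda>x t. q x t * \<rho> x t ^ Suc j)"
  have P: "?P \<rho>" if "lform n \<rho>" for \<rho>
    by (intro hpoly_mult monom hpoly_lform_power that)
  have "hpoly n (i + Suc j) (\<lambda>x t. (1 / Suc j) * (q x t * h x t ^ Suc j + (-1) * (q x t * l x t ^ Suc j)))"
    by (intro hpoly_scale hpoly.add P assms)
  then have "hpw n (Suc (i + j)) (\<lambda>x t. if h x t - l x t > 0 then
      (1 / Suc j) * (q x t * h x t ^ Suc j + (-1) * (q x t * l x t ^ Suc j)) else 0)"
    by (intro hpw.restrict hpw.poly lform_diff assms) simp
  also have "(\<lambda>x t. if h x t - l x t > 0 then
      (1 / Suc j) * (q x t * h x t ^ Suc j + (-1) * (q x t * l x t ^ Suc j)) else 0)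
    = (\<lambda>x t. integral_between (l x t) (h x t) (\<lambda>s. q x t * s ^ j))"
    by (auto simp: fun_eq_iff integral_between_power integral_between_empty set_lebesgue_integral_def[of _ "{}"] algebra_simps diff_divide_distrib
        simp del: power_Suc)
  finally show ?case .
next
  case (add d F G)
  from hpw.add[OF add(3,4)] show ?case
    by (simp add: set_integral_add set_integrable_open_interval hpoly_in_continuous[OF add.hyps(1)]
        hpoly_in_continuous[OF add.hyps(2)])
qed

text \<open>Polynomials are integrable on bounded intervals, and a cut-off multiplies by the
  indicator of a measurable set. This justifies splitting the integral of a sum.\<close>

lemma hpw_set_integrable:
  assumes "hpw (Suc n) d f"
  shows "set_integrable lborel {a<..<b} (\<lambda>s. f x (t(n := s)))"
  using assms
proof (induction rule: hpw.induct)
  case (poly d f)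
  then show ?case
    by (intro set_integrable_open_interval hpoly_in_continuous[OF hpoly_Suc_hpoly_in])
next
  case (add d f g)
  then show ?case by (intro set_integral_add)
next
  case (restrict \<phi> d f)
  from restrict(1) obtain \<psi> c where \<psi>: "\<And>x t s. \<phi> x (t(n := s)) = \<psi> x t + c * s"
    by (rule lform_SucE) blast
  have "set_integrable lborel ({s. \<psi> x t + c * s > 0}) (\<lambda>s. indicat_real {a<..<b} s *\<^sub>R f x (t(n := s)))"
    unfolding set_integrable_def
    by (rule integrable_mult_indicator[OF _ restrict(3)[unfolded set_integrable_def]]) simp
  moreover have "indicat_real {a<..<b} s *\<^sub>R (if \<phi> x (t(n := s)) > 0 then f x (t(n := s)) else 0)
      = indicat_real {s. \<psi> x t + c * s > 0} s *\<^sub>R (indicat_real {a<..<b} s *\<^sub>R f x (t(n := s)))" for s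
    by (auto simp: indicator_def \<psi>)
  ultimately show ?case by (simp only: set_integrable_def)
qed

text \<open>The ends \<open>l\<close> and \<open>h\<close> stay arbitrary in the induction on
  \<open>f\<close>, because a cut-off replaces one of them by the zero of its linear form.\<close>

lemma hpw_integral:
  assumes "hpw (Suc n) d f" "lform n l" "lform n h"
  shows "hpw n (Suc d) (\<lambda>x t. integral_between (l x t) (h x t) (\<lambda>s. f x (t(n := s))))"
  using assms
proof (induction arbitrary: l h rule: hpw.induct)
  case (poly d f)
  then show ?case by (intro hpw_integral_hpoly_in hpoly_Suc_hpoly_in)
next
  case (add d f g)
  from hpw.add[OF add.IH(1)[OF add.prems] add.IH(2)[OF add.prems]] show ?case
    by (simp add: set_integral_add hpw_set_integrable[OF add.hyps(1)] hpw_set_integrable[OF add.hyps(2)]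
        del: fun_upd_apply)
next
  case (restrict \<phi> d f)
  let ?I = "\<lambda>l h x t. integral_between (l x t) (h x t) (\<lambda>s. f x (t(n := s)))"
  from restrict(1) obtain \<psi> c where \<psi>: "lform n \<psi>" "\<And>x t s. \<phi> x (t(n := s)) = \<psi> x t + c * s"
    by (rule lform_SucE) blast
  \<comment> \<open>For nonzero \<open>c\<close> this is the zero in \<open>s\<close> of
    \<open>\<psi> x t + c * s\<close>; the sign of \<open>c\<close> decides which end of the
    interval it can move.\<close>
  define \<rho> where "\<rho> = (\<lambda>x t. - (1 / c) * \<psi> x t)"
  have \<rho>: "lform n \<rho>" unfolding \<rho>_def by (rule lform_scale[OF \<psi>(1)])
  have cong: "integral_between a b u = integral_between a' b' v"
    if "\<And>s. (if a < s \<and> s < b then u s else 0) = (if a' < s \<and> s < b' then v s else 0)" for a b a' b' and u v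
    unfolding set_lebesgue_integral_def
  proof (rule Bochner_Integration.integral_cong[OF refl])
    show "indicat_real {a<..<b} s *\<^sub>R u s = indicat_real {a'<..<b'} s *\<^sub>R v s" for s
      using that[of s] by (auto simp: indicator_def split: if_splits)
  qed
  consider "c = 0" | "c > 0" | "c < 0" by linarith
  then show ?case
  proof cases
    case 1
    have "hpw n (Suc d) (\<lambda>x t. if \<psi> x t > 0 then ?I l h x t else 0)"
      by (intro hpw.restrict restrict \<psi>)
    then show ?thesis
      by (rule back_subst[of "hpw n (Suc d)"]) (auto simp: fun_eq_iff 1 \<psi> simp del: fun_upd_apply)
  next
    case 2
    have eq: "\<psi> x t + c * s > 0 \<longleftrightarrow> s > \<rho> x t" for x t s
      using 2 pos_divide_less_eq[OF 2, of "- \<psi> x t" s] by (auto simp: \<rho>_def algebra_simps)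
    \<comment> \<open>The new lower end is the maximum of \<open>l\<close> and
      \<open>\<rho>\<close>, expressed by two complementary cut-offs.\<close>
    have "hpw n (Suc d) (\<lambda>x t. (if \<rho> x t - l x t \<le> 0 then ?I l h x t else 0)
        + (if \<rho> x t - l x t > 0 then ?I \<rho> h x t else 0))"
      by (intro hpw.add hpw_restrict_le hpw.restrict restrict \<rho> lform_diff)
    then show ?thesis
      by (rule back_subst[of "hpw n (Suc d)"]) (auto simp: fun_eq_iff \<psi> eq simp del: fun_upd_apply intro!: cong)
  next
    case 3
    have eq: "\<psi> x t + c * s > 0 \<longleftrightarrow> s < \<rho> x t" for x t s
      using 3 neg_less_divide_eq[OF 3, of s "- \<psi> x t"] by (auto simp: \<rho>_def algebra_simps)
    \<comment> \<open>Likewise the new upper end is the minimum of \<open>h\<close> and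
      \<open>\<rho>\<close>.\<close>
    have "hpw n (Suc d) (\<lambda>x t. (if h x t - \<rho> x t \<le> 0 then ?I l h x t else 0)
        + (if h x t - \<rho> x t > 0 then ?I l \<rho> x t else 0))"
      by (intro hpw.add hpw_restrict_le hpw.restrict restrict \<rho> lform_diff)
    then show ?thesis
      by (rule back_subst[of "hpw n (Suc d)"]) (auto simp: fun_eq_iff \<psi> eq simp del: fun_upd_apply intro!: cong)
  qed
qed

section \<open>Iterated integration over boxes\<close>

interpretation lborel_product: product_sigma_finite "\<lambda>_::nat. lborel :: real measure"
  by standard

lemma lform_measurable:
  assumes "lform n \<phi>" shows "\<phi> x \<in> borel_measurable (PiM {..<n} (\<lambda>_. lborel))"
proof -
  from assms obtain l c where "\<phi> = (\<lambda>x t. l x + (\<Sum>i<n. c i * t i))"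
    unfolding lform_def by blast
  then show ?thesis by simp
qed

lemma hpoly_measurable: "hpoly n d f \<Longrightarrow> f x \<in> borel_measurable (PiM {..<n} (\<lambda>_. lborel))"
  by (induction rule: hpoly.induct)
    (auto intro: borel_measurable_add borel_measurable_times lform_measurable)

lemma hpw_measurable: "hpw n d f \<Longrightarrow> f x \<in> borel_measurable (PiM {..<n} (\<lambda>_. lborel))"
proof (induction rule: hpw.induct)
  case (restrict \<phi> d f)
  note [measurable] = lform_measurable[OF restrict(1), of x] restrict(3)
  show ?case by measurable
qed (auto intro: hpoly_measurable)

text \<open>With no integration variables left, every linear form depends on \<open>x\<close>
  alone.\<close>

lemma hpw_0_indep:
  assumes "hpw 0 d f" shows "f x t = f x s"
  using assms
proof (induction rule: hpw.induct)
  case (poly d f)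
  then show ?case
  proof (induction rule: hpoly.induct)
    case (mult \<phi> d f)
    then have "\<phi> x t = \<phi> x s" by (auto simp: lform_def)
    then show ?case by (simp only: mult.IH)
  qed simp_all
next
  case (restrict \<phi> d f)
  then have "\<phi> x t = \<phi> x s" by (auto simp: lform_def)
  then show ?case by (simp only: restrict.IH)
qed simp

text \<open>Fubini's theorem removes the variables one at a time, and each integration raises the
  degree by one. Equality with \<open>ennreal (g x s)\<close> for a nonnegative \<open>g\<close>
  also records that the integral is finite.\<close>

lemma hpw_box_integral:
  fixes f :: "'a::real_vector \<Rightarrow> (nat \<Rightarrow> real) \<Rightarrow> real"
  assumes "hpw n d f" "\<And>x t. f x t \<ge> 0" "\<And>i. linear (l i)" "\<And>i. linear (h i)"
  shows "\<exists>g. hpw 0 (d + n) g \<and> (\<forall>x t. g x t \<ge> 0) \<and>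
    (\<forall>x s. (\<integral>\<^sup>+t. ennreal (f x t) * indicator {t. \<forall>i<n. l i x < t i \<and> t i < h i x} t
       \<partial>PiM {..<n} (\<lambda>_. lborel)) = ennreal (g x s))"
  using assms(1,2)
proof (induction n arbitrary: d f)
  case 0
  have *: "(\<integral>\<^sup>+t. ennreal (f x t) * indicator {t. \<forall>i<0. l i x < t i \<and> t i < h i x} t
       \<partial>PiM {..<0} (\<lambda>_. lborel)) = ennreal (f x s)" for x s
  proof -
    have "(\<integral>\<^sup>+t. ennreal (f x t) * indicator {t. \<forall>i<0. l i x < t i \<and> t i < h i x} t
       \<partial>PiM {..<0} (\<lambda>_. lborel)) = ennreal (f x (\<lambda>k. undefined))"
      by (simp add: PiM_empty nn_integral_count_space_finite)
    \<comment> \<open>The empty product measure is the unit mass at the function with constant value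
      \<open>undefined\<close>, and \<open>f x\<close> does not distinguish this point from
      \<open>s\<close>.\<close>
    then show ?thesis by (simp only: hpw_0_indep[OF 0(1), of x "\<lambda>k. undefined" s])
  qed
  have "hpw 0 (d + 0) f" using 0(1) by simp
  then show ?case using 0(2) * by (intro exI[of _ f] conjI allI)
next
  case (Suc n)
  let ?M = "\<lambda>n::nat. PiM {..<n} (\<lambda>_. lborel :: real measure)"
  let ?B = "\<lambda>n x. {t. \<forall>i<n. l i x < t i \<and> t i < h i x}"
  \<comment> \<open>The inner integral in Fubini's theorem, over the last variable. The sides of the
    box depend on \<open>x\<close> only, so what remains is a box in the other variables.\<close>
  define f' where "f' = (\<lambda>x t. integral_between (l n x) (h n x) (\<lambda>s. f x (t(n := s))))"
  have f'_hpw: "hpw n (Suc d) f'"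
    unfolding f'_def by (intro hpw_integral Suc.prems lform_linear assms)
  have f'_nonneg: "f' x t \<ge> 0" for x t
    unfolding f'_def set_lebesgue_integral_def using Suc.prems(2) by (intro Bochner_Integration.integral_nonneg) simp
  from Suc.IH[OF f'_hpw f'_nonneg] obtain g where g: "hpw 0 (Suc d + n) g" "\<And>x t. g x t \<ge> 0"
    "\<And>x s. (\<integral>\<^sup>+t. ennreal (f' x t) * indicator (?B n x) t \<partial>?M n) = ennreal (g x s)"
    by blast
  have "(\<integral>\<^sup>+t. ennreal (f x t) * indicator (?B (Suc n) x) t \<partial>?M (Suc n)) = ennreal (g x s)" for x s
  proof -
    have "(\<integral>\<^sup>+t. ennreal (f x t) * indicator (?B (Suc n) x) t \<partial>?M (Suc n))
        = (\<integral>\<^sup>+t. (\<integral>\<^sup>+s. ennreal (f x (t(n := s))) * indicator (?B (Suc n) x) (t(n := s)) \<partial>lborel) \<partial>?M n)"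
      unfolding lessThan_Suc
    proof (rule lborel_product.product_nn_integral_insert)
      show "(\<lambda>t. ennreal (f x t) * indicator (?B (Suc n) x) t)
          \<in> borel_measurable (PiM (insert n {..<n}) (\<lambda>_. lborel))"
      proof -
        have *: "Measurable.pred (PiM (insert n {..<n}) (\<lambda>_. lborel)) (\<lambda>t. \<forall>i<Suc n. l i x < t i \<and> t i < h i x)"
        proof -
          have "Measurable.pred (PiM (insert n {..<n}) (\<lambda>_. lborel)) (\<lambda>t. \<forall>i\<in>insert n {..<n}. l i x < t i \<and> t i < h i x)"
            by measurable
          then show ?thesis by (simp add: lessThan_Suc[symmetric])
        qed
        have f_meas: "f x \<in> borel_measurable (PiM (insert n {..<n}) (\<lambda>_. lborel))"
          using hpw_measurable[OF Suc.prems(1), of x] by (simp add: lessThan_Suc)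
        have eq: "(\<lambda>t. ennreal (f x t) * indicator (?B (Suc n) x) t)
          = (\<lambda>t. if \<forall>i<Suc n. l i x < t i \<and> t i < h i x then ennreal (f x t) else 0)"
          by (auto simp: fun_eq_iff)
        show ?thesis
          unfolding eq
          by (rule measurable_If[OF measurable_compose[OF f_meas measurable_ennreal] measurable_const *[unfolded pred_def]])
            simp
      qed
    qed simp_all
    also have "\<dots> = (\<integral>\<^sup>+t. ennreal (f' x t) * indicator (?B n x) t \<partial>?M n)"
    proof (rule nn_integral_cong)
      fix t
      have B_Suc: "t(n := s) \<in> ?B (Suc n) x \<longleftrightarrow> t \<in> ?B n x \<and> s \<in> {l n x<..<h n x}" for s
        unfolding All_less_Suc mem_Collect_eq by auto
      have "(\<integral>\<^sup>+s. ennreal (f x (t(n := s))) * indicator (?B (Suc n) x) (t(n := s)) \<partial>lborel)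
          = (\<integral>\<^sup>+s. ennreal (indicator {l n x<..<h n x} s *\<^sub>R f x (t(n := s))) * indicator (?B n x) t \<partial>lborel)"
        by (rule nn_integral_cong) (simp only: indicator_def B_Suc split: if_splits, simp del: fun_upd_apply)
      also have "\<dots> = (\<integral>\<^sup>+s. ennreal (indicator {l n x<..<h n x} s *\<^sub>R f x (t(n := s))) \<partial>lborel) * indicator (?B n x) t"
        by (cases "t \<in> ?B n x") (simp_all del: fun_upd_apply)
      also have "(\<integral>\<^sup>+s. ennreal (indicator {l n x<..<h n x} s *\<^sub>R f x (t(n := s))) \<partial>lborel) = ennreal (f' x t)"
        unfolding f'_def set_lebesgue_integral_def
        by (rule nn_integral_eq_integral)
          (use hpw_set_integrable[OF Suc.prems(1), of _ _ x t] Suc.prems(2) in \<open>auto simp: set_integrable_def simp del: fun_upd_apply\<close>)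
      finally show "(\<integral>\<^sup>+s. ennreal (f x (t(n := s))) * indicator (?B (Suc n) x) (t(n := s)) \<partial>lborel)
          = ennreal (f' x t) * indicator (?B n x) t" .
    qed
    also have "\<dots> = ennreal (g x s)" by (rule g(3))
    finally show ?thesis .
  qed
  moreover have "hpw 0 (d + Suc n) g" using g(1) by simp
  ultimately show ?case using g(2) by (intro exI[of _ g] conjI allI)
qed

lemma hpw_prod_indicator:
  assumes "finite E" "\<And>e. e \<in> E \<Longrightarrow> lform n (\<phi> e)"
  shows "hpw n 0 (\<lambda>x t. if \<forall>e\<in>E. \<phi> e x t > 0 then 1 else 0)"
  using assms
proof (induction E rule: finite_induct)
  case empty
  show ?case by (simp add: hpw.poly hpoly.const)
next
  case (insert e E)
  have "hpw n 0 (\<lambda>x t. if \<phi> e x t > 0 then if \<forall>e\<in>E. \<phi> e x t > 0 then 1 else 0 else 0)"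
    using insert by (intro hpw.restrict) auto
  then show ?case by (rule back_subst[of "hpw n 0"]) (auto simp: fun_eq_iff)
qed

section \<open>Slices of the positive orthant\<close>

text \<open>The part of the affine subspace \<open>a + span b\<close> in the open positive orthant, in the
  coordinates given by \<open>b\<close>.\<close>

definition slice :: "'e set \<Rightarrow> nat \<Rightarrow> (nat \<Rightarrow> 'e \<Rightarrow> real) \<Rightarrow> ('e \<Rightarrow> real) \<Rightarrow> (nat \<Rightarrow> real) set" where
  "slice E k b a = {t \<in> {..<k} \<rightarrow>\<^sub>E UNIV. \<forall>e\<in>E. a e + (\<Sum>i<k. t i * b i e) > 0}"

definition slice_volume :: "'e set \<Rightarrow> nat \<Rightarrow> (nat \<Rightarrow> 'e \<Rightarrow> real) \<Rightarrow> ('e \<Rightarrow> real) \<Rightarrow> real" where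
  "slice_volume E k b a = measure (PiM {..<k} (\<lambda>_. lborel)) (slice E k b a)"

lemma space_PiM_lborel: "space (PiM I (\<lambda>_. lborel :: real measure)) = I \<rightarrow>\<^sub>E UNIV"
  by (simp add: space_PiM)

lemma slice_measurable:
  assumes "finite E" shows "slice E k b a \<in> sets (PiM {..<k} (\<lambda>_. lborel))"
proof -
  have "{t \<in> space (PiM {..<k} (\<lambda>_. lborel)). \<forall>e\<in>E. a e + (\<Sum>i<k. t i * b i e) > 0}
      \<in> sets (PiM {..<k} (\<lambda>_. lborel))"
    by (rule sets.sets_Collect_finite_All) (use assms in measurable)
  then show ?thesis unfolding slice_def space_PiM_lborel .
qed

text \<open>The bound \<open>r\<close> encloses the slice in a cube with ends linear in
  \<open>x\<close>. Integrating the indicator of the positivity conditions over this cube gives the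
  volume, and the indicator has degree zero.\<close>

lemma slice_volume_hpw:
  fixes a :: "'a::real_vector \<Rightarrow> 'e \<Rightarrow> real"
  assumes "finite E" "\<And>e. linear (\<lambda>x. a x e)" "linear r"
    and box: "\<And>x t i. x \<in> S \<Longrightarrow> t \<in> slice E k b (a x) \<Longrightarrow> i < k \<Longrightarrow> \<bar>t i\<bar> < r x"
  shows "\<exists>g. hpw 0 k g \<and> (\<forall>x\<in>S. \<forall>s. slice_volume E k b (a x) = g x s)"
proof -
  define f where "f = (\<lambda>x t. if \<forall>e\<in>E. a x e + (\<Sum>i<k. b i e * t i) > 0 then 1 else 0 :: real)"
  have f_hpw: "hpw k 0 f"
    unfolding f_def
    by (rule hpw_prod_indicator[OF assms(1), of _ "\<lambda>e x t. a x e + (\<Sum>i<k. b i e * t i)"])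
      (auto simp: assms(1) lform_def intro!: exI[of _ "\<lambda>x. a x _"] assms(2))
  have f_nonneg: "f x t \<ge> 0" for x t by (simp add: f_def)
  have neg: "linear (\<lambda>x. - r x)" using assms(3) by (rule linear_compose_neg)
  obtain g where g: "hpw 0 k g" "\<And>x t. g x t \<ge> 0"
    "\<And>x s. (\<integral>\<^sup>+t. ennreal (f x t) * indicator {t. \<forall>i<k. - r x < t i \<and> t i < r x} t
       \<partial>PiM {..<k} (\<lambda>_. lborel)) = ennreal (g x s)"
    using hpw_box_integral[of k 0 f "\<lambda>_ x. - r x" "\<lambda>_. r", OF f_hpw f_nonneg neg assms(3)]
    unfolding add_0 by blast
  have "slice_volume E k b (a x) = g x s" if "x \<in> S" for x s
  proof -
    have "emeasure (PiM {..<k} (\<lambda>_. lborel)) (slice E k b (a x))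
        = (\<integral>\<^sup>+t. indicator (slice E k b (a x)) t \<partial>PiM {..<k} (\<lambda>_. lborel))"
      using slice_measurable[OF assms(1)] by simp
    also have "\<dots> = (\<integral>\<^sup>+t. ennreal (f x t) * indicator {t. \<forall>i<k. - r x < t i \<and> t i < r x} t
       \<partial>PiM {..<k} (\<lambda>_. lborel))"
    proof (rule nn_integral_cong)
      fix t assume "t \<in> space (PiM {..<k} (\<lambda>_. lborel :: real measure))"
      then have t: "t \<in> slice E k b (a x) \<longleftrightarrow> f x t = 1"
        by (auto simp: space_PiM_lborel slice_def f_def mult.commute)
      have t': "f x t = 1 \<or> f x t = 0" by (auto simp: f_def)
      show "indicator (slice E k b (a x)) t
          = ennreal (f x t) * indicator {t. \<forall>i<k. - r x < t i \<and> t i < r x} t"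
      proof (cases "t \<in> slice E k b (a x)")
        case True
        then have "\<forall>i<k. - r x < t i \<and> t i < r x"
          using box[OF that True] by (auto simp: abs_less_iff minus_less_iff[of _ "r x"])
        then show ?thesis using True t by simp
      qed (use t t' in simp)
    qed
    also have "\<dots> = ennreal (g x s)" by (rule g(3))
    finally show ?thesis
      using g(2)[of x s] by (simp only: slice_volume_def measure_def enn2real_ennreal)
  qed
  with g(1) show ?thesis by (intro exI[of _ g] conjI ballI allI)
qed

section \<open>Homogeneity, and polynomiality off finitely many hyperplanes\<close>

lemma hpw_homogeneous:
  assumes "hpw n d f" "r > 0"
  shows "f (r *\<^sub>R x) (\<lambda>i. r * t i) = r ^ d * f x t"
proof -
  \<comment> \<open>Linear forms scale jointly in \<open>x\<close> and \<open>t\<close>. For the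
    positive factor \<open>r\<close> this preserves every cut-off condition.\<close>
  have lf: "\<phi> (s *\<^sub>R x) (\<lambda>i. s * t i) = s * \<phi> x t" if "lform n \<phi>" for \<phi> and s :: real
    using that by (auto simp: lform_def linear_cmul sum_distrib_left algebra_simps)
  from assms(1) show ?thesis
  proof (induction rule: hpw.induct)
    case (poly d f)
    then show ?case by (induction rule: hpoly.induct) (auto simp: lf algebra_simps)
  qed (use assms(2) in \<open>auto simp: lf algebra_simps zero_less_mult_iff\<close>)
qed

lemma hpoly_0_homogeneous_polynomial:
  fixes p :: "'a::euclidean_space \<Rightarrow> (nat \<Rightarrow> real) \<Rightarrow> real"
  assumes "hpoly 0 d p" shows "homogeneous_polynomial d (\<lambda>x. p x t)"
proof -
  have lf: "\<exists>l. linear l \<and> \<phi> = (\<lambda>x t. l x)" if "lform 0 \<phi>" for \<phi> :: "'a \<Rightarrow> (nat \<Rightarrow> real) \<Rightarrow> real"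
    using that by (simp add: lform_def)
  have "real_polynomial_function (\<lambda>x. p x t) \<and> (\<forall>r x. p (r *\<^sub>R x) t = r ^ d * p x t)"
    using assms
  proof (induction rule: hpoly.induct)
    case (mult \<phi> d f)
    from lf[OF mult(1)] obtain l where "linear l" "\<phi> = (\<lambda>x t. l x)" by blast
    moreover from this have "real_polynomial_function l"
      by (intro real_polynomial_function.intros(1)) (simp add: linear_conv_bounded_linear)
    ultimately show ?case
      using mult by (auto intro: real_polynomial_function.intros(4) simp: linear_cmul)
  qed (auto intro: real_polynomial_function.intros simp: distrib_left)
  then show ?thesis by (simp add: homogeneous_polynomial_def)
qed

lemma homogeneous_polynomial_zero: "homogeneous_polynomial d (\<lambda>x::'a::euclidean_space. 0)"
  using hpoly_0_homogeneous_polynomial[OF hpoly_zero, of d] by simp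

lemma homogeneous_polynomial_add:
  "homogeneous_polynomial d p \<Longrightarrow> homogeneous_polynomial d q \<Longrightarrow> homogeneous_polynomial d (\<lambda>x. p x + q x)"
  by (auto simp: homogeneous_polynomial_def distrib_left intro: real_polynomial_function.intros)

text \<open>Any set \<open>Z\<close> on which all forms have a constant strict sign counts as part
  of a cell, connected or not, which makes the notion easy to combine. Forms that vanish on all of
  \<open>H\<close> are excluded because they define no hyperplane of \<open>H\<close>.\<close>

definition polynomial_on_sign_cells ::
  "'a::euclidean_space set \<Rightarrow> nat \<Rightarrow> ('a \<Rightarrow> real) set \<Rightarrow> ('a \<Rightarrow> real) \<Rightarrow> bool" where
  "polynomial_on_sign_cells H d \<Phi> f \<longleftrightarrow>
    finite \<Phi> \<and> (\<forall>l\<in>\<Phi>. linear l \<and> (\<exists>x\<in>H. l x \<noteq> 0)) \<and>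
    (\<forall>Z\<subseteq>H. (\<forall>l\<in>\<Phi>. (\<forall>x\<in>Z. l x > 0) \<or> (\<forall>x\<in>Z. l x < 0)) \<longrightarrow>
      (\<exists>p. homogeneous_polynomial d p \<and> (\<forall>x\<in>Z. f x = p x)))"

lemma polynomial_on_sign_cells_add:
  assumes "polynomial_on_sign_cells H d \<Phi> f" "polynomial_on_sign_cells H d \<Psi> g"
  shows "polynomial_on_sign_cells H d (\<Phi> \<union> \<Psi>) (\<lambda>x. f x + g x)"
  unfolding polynomial_on_sign_cells_def
proof (intro conjI allI impI)
  fix Z assume Z: "Z \<subseteq> H" "\<forall>l\<in>\<Phi> \<union> \<Psi>. (\<forall>x\<in>Z. l x > 0) \<or> (\<forall>x\<in>Z. l x < 0)"
  obtain p where p: "homogeneous_polynomial d p" "\<forall>x\<in>Z. f x = p x"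
    using assms(1) Z unfolding polynomial_on_sign_cells_def by (meson UnI1)
  obtain q where q: "homogeneous_polynomial d q" "\<forall>x\<in>Z. g x = q x"
    using assms(2) Z unfolding polynomial_on_sign_cells_def by (meson UnI2)
  show "\<exists>p. homogeneous_polynomial d p \<and> (\<forall>x\<in>Z. f x + g x = p x)"
    using p q by (intro exI[of _ "\<lambda>x. p x + q x"]) (simp add: homogeneous_polynomial_add)
qed (use assms in \<open>auto simp: polynomial_on_sign_cells_def\<close>)

lemma polynomial_on_sign_cells_restrict:
  fixes l :: "'a::euclidean_space \<Rightarrow> real"
  assumes f: "polynomial_on_sign_cells H d \<Phi> f" and l: "linear l"
  shows "\<exists>\<Psi>. polynomial_on_sign_cells H d \<Psi> (\<lambda>x. if l x > 0 then f x else 0)"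
proof (cases "\<exists>x\<in>H. l x \<noteq> 0")
  case True
  have "polynomial_on_sign_cells H d (insert l \<Phi>) (\<lambda>x. if l x > 0 then f x else 0)"
    unfolding polynomial_on_sign_cells_def
  proof (intro conjI allI impI)
    fix Z assume Z: "Z \<subseteq> H" "\<forall>l\<in>insert l \<Phi>. (\<forall>x\<in>Z. l x > 0) \<or> (\<forall>x\<in>Z. l x < 0)"
    obtain p where p: "homogeneous_polynomial d p" "\<forall>x\<in>Z. f x = p x"
      using f Z unfolding polynomial_on_sign_cells_def by (meson insertI2)
    from Z(2) consider "\<forall>x\<in>Z. l x > 0" | "\<forall>x\<in>Z. l x < 0" by blast
    then show "\<exists>p. homogeneous_polynomial d p \<and> (\<forall>x\<in>Z. (if l x > 0 then f x else 0) = p x)"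
    proof cases
      case 1 with p show ?thesis by (intro exI[of _ p]) simp
    next
      case 2 then show ?thesis
        by (intro exI[of _ "\<lambda>_. 0"]) (auto simp: homogeneous_polynomial_zero)
    qed
  qed (use f l True in \<open>auto simp: polynomial_on_sign_cells_def\<close>)
  then show ?thesis by blast
next
  case False
  \<comment> \<open>Here \<open>l\<close> vanishes on \<open>H\<close>, so the cut-off function is
    zero there and no hyperplane is required.\<close>
  then have "polynomial_on_sign_cells H d {} (\<lambda>x. if l x > 0 then f x else 0)"
    unfolding polynomial_on_sign_cells_def
    by (auto intro!: exI[of _ "\<lambda>_. 0"] simp: homogeneous_polynomial_zero)
  then show ?thesis by blast
qed

lemma hpw_0_sign_cells:
  fixes f :: "'a::euclidean_space \<Rightarrow> (nat \<Rightarrow> real) \<Rightarrow> real"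
  assumes "hpw 0 d f"
  shows "\<exists>\<Phi>. polynomial_on_sign_cells H d \<Phi> (\<lambda>x. f x t)"
  using assms
proof (induction rule: hpw.induct)
  case (poly d f)
  then have "polynomial_on_sign_cells H d {} (\<lambda>x. f x t)"
    using hpoly_0_homogeneous_polynomial[OF poly] unfolding polynomial_on_sign_cells_def by auto
  then show ?case by blast
next
  case (add d f g)
  then obtain \<Phi> \<Psi> where "polynomial_on_sign_cells H d \<Phi> (\<lambda>x. f x t)"
    "polynomial_on_sign_cells H d \<Psi> (\<lambda>x. g x t)" by blast
  from polynomial_on_sign_cells_add[OF this] show ?case by (rule exI)
next
  case (restrict \<phi> d f)
  from restrict(1) obtain l where "linear l" "\<phi> = (\<lambda>x t. l x)" by (auto simp: lform_def)
  with restrict.IH show ?case using polynomial_on_sign_cells_restrict by blast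
qed

text \<open>Every \<open>y\<close> in \<open>H\<close> is an element of the kernel plus a multiple
  of \<open>x\<close>, so the kernel has codimension one.\<close>

lemma hyperplane_in_kernel:
  assumes "subspace H" "linear l" "x \<in> H" "l x \<noteq> (0::real)"
  shows "hyperplane_in H {y \<in> H. l y = 0}"
proof -
  let ?W = "{y \<in> H. l y = 0}"
  have W: "subspace ?W"
    using assms by (auto simp: subspace_def linear_add linear_cmul linear_0)
  have "H \<subseteq> span (insert x ?W)"
  proof
    fix y assume y: "y \<in> H"
    have "y - (l y / l x) *\<^sub>R x \<in> ?W"
      using assms y by (auto simp: linear_diff linear_cmul subspace_diff subspace_scale)
    then have "(y - (l y / l x) *\<^sub>R x) + (l y / l x) *\<^sub>R x \<in> span (insert x ?W)"
      by (intro span_add span_scale) (auto intro: span_base)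
    then show "y \<in> span (insert x ?W)" by simp
  qed
  moreover have "insert x ?W \<subseteq> H" using assms by auto
  ultimately have "dim H = dim (insert x ?W)"
    by (intro antisym dim_mono) (auto intro: dim_subset span_base)
  also have "\<dots> = dim ?W + 1"
    using assms(4) by (simp add: dim_insert span_eq_iff[THEN iffD2, OF W])
  finally show ?thesis using W by (auto simp: hyperplane_in_def)
qed

lemma connected_linear_sign:
  assumes "connected C" "linear l" "\<forall>x\<in>C. l x \<noteq> (0::real)"
  shows "(\<forall>x\<in>C. l x > 0) \<or> (\<forall>x\<in>C. l (x::'a::euclidean_space) < 0)"
proof (rule ccontr)
  assume "\<not> ?thesis"
  then obtain x y where "x \<in> C" "l x \<le> 0" "y \<in> C" "l y \<ge> 0" by (auto simp: not_less)
  moreover have "connected (l ` C)"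
    using assms(1,2) by (intro connected_continuous_image linear_continuous_on)
      (auto simp: linear_conv_bounded_linear)
  ultimately have "0 \<in> l ` C" by (meson connectedD_interval imageI)
  then show False using assms(3) by auto
qed

text \<open>A component of the complement is connected and avoids the kernels of the forms, hence
  each form has a constant sign on it by the intermediate value theorem.\<close>

lemma hpw_0_piecewise:
  fixes f :: "'a::euclidean_space \<Rightarrow> (nat \<Rightarrow> real) \<Rightarrow> real"
  assumes "hpw 0 d f" "subspace H" "S \<subseteq> H"
  shows "piecewise_homogeneous_polynomial_on S H d (\<lambda>x. f x t)"
proof -
  obtain \<Phi> where \<Phi>: "polynomial_on_sign_cells H d \<Phi> (\<lambda>x. f x t)"
    using hpw_0_sign_cells[OF assms(1)] by blast
  let ?W = "(\<lambda>l. {y \<in> H. l y = 0}) ` \<Phi>"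
  show ?thesis
    unfolding piecewise_homogeneous_polynomial_on_def
  proof (intro exI[of _ ?W] conjI ballI)
    show "hyperplane_in H W" if "W \<in> ?W" for W
      using that \<Phi> hyperplane_in_kernel[OF assms(2)] unfolding polynomial_on_sign_cells_def by blast
    fix C assume C: "C \<in> components (S - \<Union>?W)"
    have C_sub: "C \<subseteq> S - \<Union>?W" using C by (rule in_components_subset)
    have C_conn: "connected C" using C by (rule in_components_connected)
    have "\<forall>l\<in>\<Phi>. (\<forall>x\<in>C. l x > 0) \<or> (\<forall>x\<in>C. l x < 0)"
    proof
      fix l assume l: "l \<in> \<Phi>"
      have "\<forall>x\<in>C. l x \<noteq> 0" using C_sub l assms(3) by blast
      then show "(\<forall>x\<in>C. l x > 0) \<or> (\<forall>x\<in>C. l x < 0)"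
        using \<Phi> l connected_linear_sign[OF C_conn] unfolding polynomial_on_sign_cells_def by blast
    qed
    moreover have "C \<subseteq> H" using C_sub assms(3) by blast
    ultimately show "\<exists>p. homogeneous_polynomial d p \<and> (\<forall>x\<in>C. f x t = p x)"
      using \<Phi> unfolding polynomial_on_sign_cells_def by blast
  qed (use \<Phi> in \<open>simp add: polynomial_on_sign_cells_def\<close>)
qed

lemma PiM_lborel_translation:
  fixes c :: "nat \<Rightarrow> real"
  assumes "finite I"
  shows "distr (PiM I (\<lambda>_. lborel)) (PiM I (\<lambda>_. lborel)) (\<lambda>t. \<lambda>i\<in>I. c i + t i) = PiM I (\<lambda>_. lborel)"
    (is "distr ?M _ ?T = _")
proof (rule lborel_product.PiM_eqI[OF assms])
  have T: "?T \<in> measurable ?M ?M" by measurable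
  fix A assume A: "\<And>i. i \<in> I \<Longrightarrow> A i \<in> sets (lborel :: real measure)"
  \<comment> \<open>The product measure is determined by its values on boxes, and there the claim is
    translation invariance in each coordinate.\<close>
  have "emeasure (distr ?M ?M ?T) (Pi\<^sub>E I A) = emeasure ?M (?T -` Pi\<^sub>E I A \<inter> space ?M)"
    using A assms by (intro emeasure_distr T sets_PiM_I_finite) auto
  also have "?T -` Pi\<^sub>E I A \<inter> space ?M = Pi\<^sub>E I (\<lambda>i. (+) (c i) -` A i)"
    by (auto simp: space_PiM PiE_iff)
  also have "emeasure ?M \<dots> = (\<Prod>i\<in>I. emeasure lborel ((+) (c i) -` A i))"
  proof (rule lborel_product.emeasure_PiM[OF assms])
    fix i assume "i \<in> I"
    then have "(+) (c i) -` A i \<inter> space borel \<in> sets borel"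
      using A by (intro measurable_sets[of _ borel borel]) auto
    then show "(+) (c i) -` A i \<in> sets lborel" by simp
  qed
  also have "\<dots> = (\<Prod>i\<in>I. emeasure lborel (A i))"
  proof (rule prod.cong[OF refl])
    fix i assume "i \<in> I"
    then have "A i \<in> sets borel" using A by auto
    then have "emeasure (distr lborel borel ((+) (c i))) (A i) = emeasure lborel ((+) (c i) -` A i)"
      by (subst emeasure_distr) auto
    then show "emeasure lborel ((+) (c i) -` A i) = emeasure lborel (A i)"
      by (simp add: lborel_distr_plus)
  qed
  finally show "emeasure (distr ?M ?M ?T) (Pi\<^sub>E I A) = (\<Prod>i\<in>I. emeasure lborel (A i))" .
qed simp

text \<open>Moving the base point along the span of \<open>b\<close> translates the slice in the
  coordinates. This makes the base point chosen in \<open>lattice_volume\<close> immaterial.\<close>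

lemma slice_volume_translation:
  assumes "finite E"
  shows "slice_volume E k b (\<lambda>e. a e + (\<Sum>i<k. c i * b i e)) = slice_volume E k b a"
proof -
  let ?M = "PiM {..<k} (\<lambda>_. lborel :: real measure)" and ?T = "\<lambda>t. \<lambda>i\<in>{..<k}. c i + t i"
  have "measure ?M (slice E k b a) = measure (distr ?M ?M ?T) (slice E k b a)"
    by (simp add: PiM_lborel_translation)
  also have "\<dots> = measure ?M (?T -` slice E k b a \<inter> space ?M)"
    by (intro measure_distr slice_measurable assms) measurable
  also have "?T -` slice E k b a \<inter> space ?M = slice E k b (\<lambda>e. a e + (\<Sum>i<k. c i * b i e))"
    by (auto simp: slice_def space_PiM algebra_simps sum.distrib)
  finally show ?thesis by (simp add: slice_volume_def)
qed

text \<open>By Fubini's theorem in the coordinate \<open>j\<close>: once the other coordinates are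
  fixed, the equation leaves at most one value for it.\<close>

lemma hyperplane_null:
  fixes j k :: nat
  assumes "b j \<noteq> (0::real)" "j < k"
  shows "{t \<in> space (PiM {..<k} (\<lambda>_. lborel)). a + (\<Sum>i<k. t i * b i) = 0}
    \<in> null_sets (PiM {..<k} (\<lambda>_. lborel))" (is "?N \<in> _")
proof -
  obtain I where I: "finite I" "j \<notin> I" "insert j I = {..<k}"
    using assms by (auto intro: that[of "{..<k} - {j}"])
  have meas: "?N \<in> sets (PiM {..<k} (\<lambda>_. lborel))" by measurable
  have "emeasure (PiM {..<k} (\<lambda>_. lborel)) ?N = (\<integral>\<^sup>+t. indicator ?N t \<partial>PiM (insert j I) (\<lambda>_. lborel))"
    using meas unfolding I(3) by simp
  also have "\<dots> = (\<integral>\<^sup>+t. (\<integral>\<^sup>+s. indicator ?N (t(j := s)) \<partial>lborel) \<partial>PiM I (\<lambda>_. lborel))"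
    by (rule lborel_product.product_nn_integral_insert[of I j "indicator ?N", OF I(1,2)])
      (use meas in \<open>simp add: I(3) borel_measurable_indicator\<close>)
  also have "\<dots> = (\<integral>\<^sup>+t. 0 \<partial>PiM I (\<lambda>_. lborel :: real measure))"
  proof (rule nn_integral_cong)
    fix t
    define r where "r = - (a + (\<Sum>i\<in>I. t i * b i)) / b j"
    have "(\<Sum>i<k. (t(j := s)) i * b i) = s * b j + (\<Sum>i\<in>I. t i * b i)" for s
      using I by (auto simp flip: I(3) intro!: sum.cong)
    then have "t(j := s) \<in> ?N \<Longrightarrow> s = r" for s
      using assms(1) by (simp add: r_def field_simps)
    then have "(\<integral>\<^sup>+s. indicator ?N (t(j := s)) \<partial>lborel) \<le> (\<integral>\<^sup>+s. indicator {r} s \<partial>lborel)"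
      by (intro nn_integral_mono) (auto simp: indicator_def simp del: fun_upd_apply)
    then show "(\<integral>\<^sup>+s. indicator ?N (t(j := s)) \<partial>lborel) = 0" by simp
  qed
  finally show ?thesis using meas by (simp add: null_sets_def)
qed

lemma slice_volume_continuous:
  fixes a :: "'a::euclidean_space \<Rightarrow> 'e \<Rightarrow> real"
  assumes "finite E" "\<And>e. linear (\<lambda>x. a x e)" "linear r"
    and box: "\<And>x t i. x \<in> S \<Longrightarrow> t \<in> slice E k b (a x) \<Longrightarrow> i < k \<Longrightarrow> \<bar>t i\<bar> < r x"
    and row: "\<And>e x. e \<in> E \<Longrightarrow> x \<in> S \<Longrightarrow> (\<forall>i<k. b i e = 0) \<Longrightarrow> a x e > 0"
  shows "continuous_on S (\<lambda>x. slice_volume E k b (a x))"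
  unfolding continuous_on_sequentially
proof (intro allI ballI impI)
  let ?M = "PiM {..<k} (\<lambda>_. lborel :: real measure)"
  fix X x assume x: "x \<in> S" and X: "(\<forall>n. X n \<in> S) \<and> X \<longlonglongrightarrow> x"
  have lim: "(\<lambda>n. l (X n)) \<longlonglongrightarrow> l x" if "linear l" for l :: "'a \<Rightarrow> real"
    using X that by (auto intro: bounded_linear.tendsto simp: linear_conv_bounded_linear)
  have "convergent (\<lambda>n. r (X n))" using lim[OF assms(3)] by (auto simp: convergent_def)
  then obtain K where K: "\<And>n. norm (r (X n)) \<le> K"
    by (meson convergent_imp_Bseq BseqE)
  \<comment> \<open>The radii along a convergent sequence are bounded, so one cube contains all
    slices; its indicator is the dominating function.\<close>
  define B where "B = Pi\<^sub>E {..<k} (\<lambda>_. {-K..K})"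
  have B: "B \<in> sets ?M" unfolding B_def by (intro sets_PiM_I_finite) auto
  have "emeasure ?M B = (\<Prod>i<k. emeasure lborel {-K..K})"
    unfolding B_def by (rule lborel_product.emeasure_PiM) auto
  also have "\<dots> < \<infinity>" by (simp add: emeasure_lborel_Icc_eq power_less_top_ennreal ennreal_zero_less_top)
  finally have finB: "emeasure ?M B < \<infinity>" .
  have sub: "slice E k b (a (X n)) \<subseteq> B" for n
  proof
    fix t assume t: "t \<in> slice E k b (a (X n))"
    have "- K \<le> t i \<and> t i \<le> K" if "i < k" for i
      using box[OF _ t that] X K[of n] by (force simp: abs_le_iff)
    then show "t \<in> B" using t by (auto simp: B_def slice_def PiE_iff)
  qed
  have ae: "AE t in ?M. (\<lambda>n. indicat_real (slice E k b (a (X n))) t) \<longlonglongrightarrow> indicator (slice E k b (a x)) t"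
  proof -
    have nz: "AE t in ?M. \<forall>e\<in>E. a x e + (\<Sum>i<k. t i * b i e) \<noteq> 0"
    proof (rule AE_finite_allI[OF assms(1)])
      fix e assume e: "e \<in> E"
      show "AE t in ?M. a x e + (\<Sum>i<k. t i * b i e) \<noteq> 0"
      proof (cases "\<forall>i<k. b i e = 0")
        case True
        then show ?thesis using row[OF e x True] by simp
      next
        case False
        then obtain j where "b j e \<noteq> 0" "j < k" by auto
        from hyperplane_null[of "\<lambda>i. b i e", OF this, of "a x e"] show ?thesis
          by (rule AE_I') auto
      qed
    qed
    show ?thesis
      using nz AE_space
    proof eventually_elim
      case (elim t)
      \<comment> \<open>Off the limiting hyperplanes each condition holds or fails strictly at
        \<open>x\<close>, hence has the same truth value at \<open>X n\<close> for large
        \<open>n\<close>.\<close>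
      have "eventually (\<lambda>n. (a (X n) e + (\<Sum>i<k. t i * b i e) > 0) = (a x e + (\<Sum>i<k. t i * b i e) > 0)) sequentially"
        if e: "e \<in> E" for e
      proof -
        let ?c = "\<Sum>i<k. t i * b i e"
        have l: "(\<lambda>n. a (X n) e + ?c) \<longlonglongrightarrow> a x e + ?c"
          by (intro tendsto_intros lim assms)
        consider "a x e + ?c > 0" | "a x e + ?c < 0" using elim(1)[rule_format, OF e] by linarith
        then show ?thesis
        proof cases
          case 1 from order_tendstoD(1)[OF l this] show ?thesis by eventually_elim (use 1 in auto)
        next
          case 2 from order_tendstoD(2)[OF l this] show ?thesis by eventually_elim (use 2 in auto)
        qed
      qed
      then have "eventually (\<lambda>n. \<forall>e\<in>E. (a (X n) e + (\<Sum>i<k. t i * b i e) > 0)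
          = (a x e + (\<Sum>i<k. t i * b i e) > 0)) sequentially"
        using assms(1) by (simp add: eventually_ball_finite)
      then have "eventually (\<lambda>n. indicat_real (slice E k b (a (X n))) t = indicator (slice E k b (a x)) t) sequentially"
        by eventually_elim (auto simp: slice_def indicator_def)
      then show ?case by (rule tendsto_eventually)
    qed
  qed
  have "(\<lambda>n. LINT t|?M. indicat_real (slice E k b (a (X n))) t) \<longlonglongrightarrow> (LINT t|?M. indicat_real (slice E k b (a x)) t)"
  proof (rule integral_dominated_convergence[where w = "indicat_real B"])
    show "integrable ?M (indicat_real B)" using B finB by (simp add: integrable_indicator_iff)
  qed (use ae sub slice_measurable[OF assms(1)] in \<open>auto simp: indicator_def\<close>)
  then show "((\<lambda>x. slice_volume E k b (a x)) \<circ> X) \<longlonglongrightarrow> slice_volume E k b (a x)"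
    unfolding slice_volume_def o_def
    using slice_measurable[OF assms(1), of k b, THEN sets.Int_space_eq2] by (simp add: Int_absorb2)
qed

section \<open>Flows on multigraphs and lattice bases\<close>

text \<open>Connectedness is stated through cuts, because a cut supplies exactly the edge by which a
  partial tree can be enlarged. The maps \<open>p\<close> and \<open>q\<close> give the two ends of
  an edge.\<close>

locale finite_connected_multigraph =
  fixes E :: "'e set" and B :: "'b set" and p q :: "'e \<Rightarrow> 'b"
  assumes finite_E: "finite E" and finite_B: "finite B" and B_nonempty: "B \<noteq> {}"
    and p_in: "e \<in> E \<Longrightarrow> p e \<in> B" and q_in: "e \<in> E \<Longrightarrow> q e \<in> B"
    and cut: "S \<subseteq> B \<Longrightarrow> S \<noteq> {} \<Longrightarrow> S \<noteq> B \<Longrightarrow> \<exists>e\<in>E. (p e \<in> S) \<noteq> (q e \<in> S)"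
begin

text \<open>The signed incidence matrix; the column of a loop is zero.\<close>

definition inc :: "'e \<Rightarrow> 'b \<Rightarrow> real" where
  "inc e \<beta> = of_bool (p e = \<beta>) - of_bool (q e = \<beta>)"

lemma sum_inc: "e \<in> E \<Longrightarrow> (\<Sum>\<beta>\<in>B. inc e \<beta>) = 0"
  using finite_B p_in q_in by (simp add: inc_def sum_subtractf of_bool_def)

text \<open>\<open>T\<close> is a tree with node set \<open>S\<close>, and the integral matrix \<open>C\<close> inverts its incidence matrix on
  the vectors with sum zero.\<close>

definition partial_tree :: "'b set \<Rightarrow> 'e set \<Rightarrow> ('e \<Rightarrow> 'b \<Rightarrow> real) \<Rightarrow> bool" where
  "partial_tree S T C \<longleftrightarrow> S \<subseteq> B \<and> S \<noteq> {} \<and> T \<subseteq> E \<and> card T + 1 = card S \<and>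
     (\<forall>e\<in>T. p e \<in> S \<and> q e \<in> S) \<and> (\<forall>e \<beta>. C e \<beta> \<in> \<int>) \<and>
     (\<forall>w x. sum w S = 0 \<longrightarrow>
       ((\<forall>\<beta>\<in>S. (\<Sum>e\<in>T. inc e \<beta> * x e) = w \<beta>) \<longleftrightarrow> (\<forall>e\<in>T. x e = (\<Sum>\<beta>\<in>S. C e \<beta> * w \<beta>))))"

text \<open>An edge \<open>e\<close> across the cut attaches a new node \<open>u\<close> to a node
  \<open>v\<close> of the tree. It is the only tree edge at \<open>u\<close>, so the equation at
  \<open>u\<close> determines \<open>x e\<close>, and the old tree solves the rest with a corrected
  demand at \<open>v\<close>.\<close>

lemma partial_tree_step:
  assumes "partial_tree S T C" "S \<noteq> B"
  shows "\<exists>S' T' C'. partial_tree S' T' C' \<and> card S' = card S + 1"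
proof -
  have S: "S \<subseteq> B" "S \<noteq> {}" "T \<subseteq> E" "card T + 1 = card S" "\<And>e. e \<in> T \<Longrightarrow> p e \<in> S" "\<And>e. e \<in> T \<Longrightarrow> q e \<in> S"
    "\<And>e \<beta>. C e \<beta> \<in> \<int>"
    and sol: "\<And>w x. sum w S = 0 \<Longrightarrow>
       (\<forall>\<beta>\<in>S. (\<Sum>e\<in>T. inc e \<beta> * x e) = w \<beta>) \<longleftrightarrow> (\<forall>e\<in>T. x e = (\<Sum>\<beta>\<in>S. C e \<beta> * w \<beta>))"
    using assms(1) by (simp_all add: partial_tree_def)
  have fin: "finite S" "finite T" using S finite_B finite_E finite_subset by blast+
  from cut[OF S(1,2) assms(2)] obtain e where e: "e \<in> E" "(p e \<in> S) \<noteq> (q e \<in> S)" by blast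
  obtain u v where uv: "u \<in> B" "u \<notin> S" "v \<in> S" "{p e, q e} = {u, v}"
  proof (cases "p e \<in> S")
    case True
    with e q_in show ?thesis by (intro that[of "q e" "p e"]) auto
  next
    case False
    with e p_in show ?thesis by (intro that[of "p e" "q e"]) auto
  qed
  \<comment> \<open>The incidence of \<open>e\<close> at its new end is \<open>1\<close> or
    \<open>-1\<close>, so it is its own inverse and dividing by it keeps integrality.\<close>
  define \<sigma> where "\<sigma> = inc e u"
  have \<sigma>: "\<sigma> * \<sigma> = 1" "\<sigma> \<in> \<int>" "inc e v = - \<sigma>" "\<And>\<beta>. \<beta> \<noteq> u \<Longrightarrow> \<beta> \<noteq> v \<Longrightarrow> inc e \<beta> = 0"
    using uv by (auto simp: \<sigma>_def inc_def doubleton_eq_iff)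
  have e_T: "e \<notin> T" using S e by blast
  have inc_T: "inc f u = 0" if "f \<in> T" for f using S(5,6)[OF that] uv(2) by (auto simp: inc_def)
  \<comment> \<open>The row of \<open>e\<close> solves the equation at \<open>u\<close>. In the
    other rows the demand at \<open>u\<close> counts as demand at \<open>v\<close>, so column
    \<open>u\<close> copies column \<open>v\<close>.\<close>
  define C' where "C' = (\<lambda>f \<beta>. if f = e then if \<beta> = u then \<sigma> else 0 else if \<beta> = u then C f v else C f \<beta>)"
  have "partial_tree (insert u S) (insert e T) C'"
    unfolding partial_tree_def
  proof (intro conjI allI impI ballI)
    fix w x assume w: "sum w (insert u S) = (0::real)"
    \<comment> \<open>The demand of \<open>u\<close> is passed on to \<open>v\<close>, so the total
      on \<open>S\<close> remains zero.\<close>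
    define w' where "w' = (\<lambda>\<beta>. w \<beta> + (if \<beta> = v then w u else 0))"
    have w': "sum w' S = 0"
      using w uv fin by (simp add: w'_def sum.distrib)
    have T_sum: "(\<Sum>f\<in>insert e T. inc f \<beta> * x f) = (\<Sum>f\<in>T. inc f \<beta> * x f) + inc e \<beta> * x e" for \<beta>
      using e_T fin by simp
    have "(\<forall>\<beta>\<in>insert u S. (\<Sum>f\<in>insert e T. inc f \<beta> * x f) = w \<beta>)
        \<longleftrightarrow> \<sigma> * x e = w u \<and> (\<forall>\<beta>\<in>S. (\<Sum>f\<in>T. inc f \<beta> * x f) + inc e \<beta> * x e = w \<beta>)"
      by (simp add: T_sum inc_T \<sigma>_def)
    also have "\<dots> \<longleftrightarrow> x e = \<sigma> * w u \<and> (\<forall>\<beta>\<in>S. (\<Sum>f\<in>T. inc f \<beta> * x f) = w' \<beta>)"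
    proof (rule conj_cong)
      show "\<sigma> * x e = w u \<longleftrightarrow> x e = \<sigma> * w u"
        using \<sigma>(1) by (metis mult.assoc mult_1)
      assume xe: "x e = \<sigma> * w u"
      have "inc e \<beta> * x e = w \<beta> - w' \<beta>" if "\<beta> \<in> S" for \<beta>
      proof (cases "\<beta> = v")
        case True
        then show ?thesis using \<sigma>(1,3) by (simp add: w'_def xe flip: mult.assoc)
      next
        case False
        moreover have "\<beta> \<noteq> u" using that uv(2) by auto
        ultimately show ?thesis using \<sigma>(4) by (simp add: w'_def)
      qed
      then show "(\<forall>\<beta>\<in>S. (\<Sum>f\<in>T. inc f \<beta> * x f) + inc e \<beta> * x e = w \<beta>)
          \<longleftrightarrow> (\<forall>\<beta>\<in>S. (\<Sum>f\<in>T. inc f \<beta> * x f) = w' \<beta>)"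
        by (intro ball_cong refl) auto
    qed
    also have "\<dots> \<longleftrightarrow> x e = \<sigma> * w u \<and> (\<forall>f\<in>T. x f = (\<Sum>\<beta>\<in>S. C f \<beta> * w' \<beta>))"
      using sol[OF w'] by blast
    also have "\<dots> \<longleftrightarrow> (\<forall>f\<in>insert e T. x f = (\<Sum>\<beta>\<in>insert u S. C' f \<beta> * w \<beta>))"
    proof -
      have "(\<Sum>\<beta>\<in>insert u S. C' f \<beta> * w \<beta>) = (\<Sum>\<beta>\<in>S. C f \<beta> * w' \<beta>)" if "f \<in> T" for f
      proof -
        have "(\<Sum>\<beta>\<in>insert u S. C' f \<beta> * w \<beta>) = C f v * w u + (\<Sum>\<beta>\<in>S. C f \<beta> * w \<beta>)"
          using that e_T uv(2) fin by (auto simp: C'_def intro!: sum.cong)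
        also have "\<dots> = (\<Sum>\<beta>\<in>S. (if \<beta> = v then C f v * w u else 0) + C f \<beta> * w \<beta>)"
          using uv(3) fin by (simp add: sum.distrib)
        also have "\<dots> = (\<Sum>\<beta>\<in>S. C f \<beta> * w' \<beta>)"
          by (intro sum.cong refl) (simp add: w'_def distrib_left)
        finally show ?thesis .
      qed
      moreover have "(\<Sum>\<beta>\<in>insert u S. C' e \<beta> * w \<beta>) = \<sigma> * w u"
        using uv(2) fin by (auto simp: C'_def intro!: sum.neutral)
      ultimately show ?thesis by auto
    qed
    finally show "(\<forall>\<beta>\<in>insert u S. (\<Sum>f\<in>insert e T. inc f \<beta> * x f) = w \<beta>)
        \<longleftrightarrow> (\<forall>f\<in>insert e T. x f = (\<Sum>\<beta>\<in>insert u S. C' f \<beta> * w \<beta>))" .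
  next
    show "card (insert e T) + 1 = card (insert u S)" using S uv e_T fin by simp
    show "C' f \<beta> \<in> \<int>" for f \<beta> using S(7) \<sigma>(2) by (simp add: C'_def)
  qed (use S uv e in auto)
  then show ?thesis using uv fin by (intro exI conjI) auto
qed

lemma spanning_tree:
  obtains T C where "partial_tree B T C"
proof -
  obtain \<beta> where \<beta>: "\<beta> \<in> B" using B_nonempty by blast
  have "\<exists>S T C. partial_tree S T C \<and> card S = Suc n" if "n < card B" for n
    using that
  proof (induction n)
    case 0
    have "partial_tree {\<beta>} {} (\<lambda>_ _. 0)" using \<beta> by (auto simp: partial_tree_def)
    then show ?case by force
  next
    case (Suc n)
    then obtain S T C where S: "partial_tree S T C" "card S = Suc n" by auto
    then have "S \<noteq> B" using Suc.prems by auto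
    from partial_tree_step[OF S(1) this] S(2) show ?case by auto
  qed
  from this[of "card B - 1"] obtain S T C where S: "partial_tree S T C" "card S = card B"
    using B_nonempty finite_B by (auto simp: card_gt_0_iff)
  then have "S = B" using finite_B by (intro card_subset_eq) (auto simp: partial_tree_def)
  with S that show ?thesis by blast
qed

text \<open>The terms of the edges outside a spanning tree are moved to the other side, and the tree
  equations are solved by \<open>C\<close>. The coefficients \<open>c\<close> are integral because
  both \<open>C\<close> and the incidence matrix are.\<close>

lemma flow_parametrization:
  obtains T C c where "T \<subseteq> E" "card T + 1 = card B" "\<And>e f. c e f \<in> \<int>"
    "\<And>w x. sum w B = 0 \<Longrightarrow> (\<forall>\<beta>\<in>B. (\<Sum>e\<in>E. inc e \<beta> * x e) = w \<beta>) \<longleftrightarrow>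
      (\<forall>e\<in>T. x e = (\<Sum>\<beta>\<in>B. C e \<beta> * w \<beta>) + (\<Sum>f\<in>E - T. c e f * x f))"
proof -
  obtain T C where "partial_tree B T C" by (rule spanning_tree)
  then have T: "T \<subseteq> E" "card T + 1 = card B" "\<And>e \<beta>. C e \<beta> \<in> \<int>"
    and sol: "\<And>w x. sum w B = 0 \<Longrightarrow>
       (\<forall>\<beta>\<in>B. (\<Sum>e\<in>T. inc e \<beta> * x e) = w \<beta>) \<longleftrightarrow> (\<forall>e\<in>T. x e = (\<Sum>\<beta>\<in>B. C e \<beta> * w \<beta>))"
    by (simp_all add: partial_tree_def)
  define c where "c = (\<lambda>e f. - (\<Sum>\<beta>\<in>B. C e \<beta> * inc f \<beta>))"
  show ?thesis
  proof (rule that[of T c C])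
    show "c e f \<in> \<int>" for e f
      using T(3) by (auto simp: c_def inc_def intro!: Ints_sum Ints_mult Ints_diff)
    fix w :: "'b \<Rightarrow> real" and x assume w: "sum w B = 0"
    define w' where "w' = (\<lambda>\<beta>. w \<beta> - (\<Sum>f\<in>E - T. inc f \<beta> * x f))"
    \<comment> \<open>The incidences of each edge sum to zero, so the modified demand
      \<open>w'\<close> is again balanced.\<close>
    have "(\<Sum>\<beta>\<in>B. \<Sum>f\<in>E - T. inc f \<beta> * x f) = (\<Sum>f\<in>E - T. (\<Sum>\<beta>\<in>B. inc f \<beta>) * x f)"
      by (subst sum.swap) (simp add: sum_distrib_right)
    also have "\<dots> = 0" by (simp add: sum_inc)
    finally have w': "sum w' B = 0" using w by (simp add: w'_def sum_subtractf)
    have "(\<Sum>e\<in>E. inc e \<beta> * x e) = (\<Sum>e\<in>T. inc e \<beta> * x e) + (\<Sum>e\<in>E - T. inc e \<beta> * x e)" for \<beta>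
      using sum.subset_diff[OF T(1) finite_E, of "\<lambda>e. inc e \<beta> * x e"] by simp
    then have "(\<forall>\<beta>\<in>B. (\<Sum>e\<in>E. inc e \<beta> * x e) = w \<beta>) \<longleftrightarrow> (\<forall>\<beta>\<in>B. (\<Sum>e\<in>T. inc e \<beta> * x e) = w' \<beta>)"
      by (intro ball_cong refl) (auto simp: w'_def)
    also have "\<dots> \<longleftrightarrow> (\<forall>e\<in>T. x e = (\<Sum>\<beta>\<in>B. C e \<beta> * w' \<beta>))" by (rule sol[OF w'])
    also have "(\<lambda>e. \<Sum>\<beta>\<in>B. C e \<beta> * w' \<beta>) = (\<lambda>e. (\<Sum>\<beta>\<in>B. C e \<beta> * w \<beta>) + (\<Sum>f\<in>E - T. c e f * x f))"
    proof
      fix e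
      have "(\<Sum>\<beta>\<in>B. C e \<beta> * (\<Sum>f\<in>E - T. inc f \<beta> * x f)) = (\<Sum>f\<in>E - T. (\<Sum>\<beta>\<in>B. C e \<beta> * inc f \<beta>) * x f)"
        by (simp add: sum_distrib_left sum_distrib_right mult.assoc) (rule sum.swap)
      then show "(\<Sum>\<beta>\<in>B. C e \<beta> * w' \<beta>) = (\<Sum>\<beta>\<in>B. C e \<beta> * w \<beta>) + (\<Sum>f\<in>E - T. c e f * x f)"
        by (simp add: w'_def c_def right_diff_distrib sum_subtractf sum_negf)
    qed
    finally show "(\<forall>\<beta>\<in>B. (\<Sum>e\<in>E. inc e \<beta> * x e) = w \<beta>) \<longleftrightarrow>
      (\<forall>e\<in>T. x e = (\<Sum>\<beta>\<in>B. C e \<beta> * w \<beta>) + (\<Sum>f\<in>E - T. c e f * x f))" .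
  qed (use T in auto)
qed

end

section \<open>Lattice bases of coordinate lattices, and volumes in their coordinates\<close>

text \<open>A subspace \<open>K\<close> of \<open>\<real>\<^sup>E\<close> which projects isomorphically to \<open>\<real>\<^sup>N\<close>; the integer vectors \<open>u f\<close>
  are the preimages of the standard basis vectors.\<close>

locale coordinate_lattice =
  fixes E N :: "'e set" and u :: "'e \<Rightarrow> 'e \<Rightarrow> real" and K :: "('e \<Rightarrow> real) set"
  assumes finite_E: "finite E" and N_subset: "N \<subseteq> E"
    and u_int: "u f e \<in> \<int>"
    and u_N: "f \<in> N \<Longrightarrow> f' \<in> N \<Longrightarrow> u f f' = of_bool (f = f')"
    and K_iff: "v \<in> K \<longleftrightarrow> v \<in> E \<rightarrow>\<^sub>E UNIV \<and> (\<forall>e\<in>E. v e = (\<Sum>f\<in>N. v f * u f e))"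
begin

lemma finite_N: "finite N"
  using finite_subset[OF N_subset finite_E] .

lemma combination_in_K:
  assumes v: "v = (\<lambda>e\<in>E. \<Sum>f\<in>N. y f * u f e)" shows "v \<in> K" "f \<in> N \<Longrightarrow> v f = y f"
proof -
  have *: "v f = y f" if "f \<in> N" for f
  proof -
    have "v f = (\<Sum>g\<in>N. y g * of_bool (g = f))" using that N_subset by (auto simp: v u_N intro!: sum.cong)
    also have "\<dots> = y f" using that finite_N by simp
    finally show ?thesis .
  qed
  then show "f \<in> N \<Longrightarrow> v f = y f" .
  show "v \<in> K" unfolding K_iff using * by (auto simp: v intro!: sum.cong)
qed

text \<open>The vectors \<open>u f\<close>, enumerated by \<open>\<nu>\<close>, form such a basis:
  the coefficients of a vector of \<open>K\<close> are its own entries on \<open>N\<close>, and the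
  \<open>u f\<close> are integral, so integral vectors correspond to integral coefficients.\<close>

lemma lattice_basis_exists: "\<exists>b. lattice_basis E K (card N) b"
proof -
  let ?n = "card N"
  obtain \<nu> where \<nu>: "bij_betw \<nu> {..<?n} N"
    using ex_bij_betw_nat_finite[OF finite_N] by (auto simp: atLeast0LessThan)
  define b where "b = (\<lambda>i. u (\<nu> i))"
  define \<nu>' where "\<nu>' = the_inv_into {..<?n} \<nu>"
  have \<nu>': "\<nu>' (\<nu> i) = i" if "i < ?n" for i
    using \<nu> that by (auto simp: \<nu>'_def the_inv_into_f_f bij_betw_def)
  have \<nu>_N: "\<nu> i \<in> N" if "i < ?n" for i using \<nu> that by (auto simp: bij_betw_def)
  have comb: "lin_comb E ?n b t = (\<lambda>e\<in>E. \<Sum>f\<in>N. t (\<nu>' f) * u f e)" for t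
    unfolding lin_comb_def b_def
    by (subst sum.reindex_bij_betw[OF \<nu>, symmetric]) (simp add: \<nu>' cong: restrict_cong)
  have inK: "lin_comb E ?n b t \<in> K" and coord: "\<And>i. i < ?n \<Longrightarrow> lin_comb E ?n b t (\<nu> i) = t i" for t
    using combination_in_K[OF comb] by (simp_all add: \<nu>_N \<nu>')
  have inv: "lin_comb E ?n b (\<lambda>i\<in>{..<?n}. v (\<nu> i)) = v" if "v \<in> K" for v
  proof
    fix e
    have "(\<Sum>i<?n. v (\<nu> i) * u (\<nu> i) e) = (\<Sum>f\<in>N. v f * u f e)"
      by (rule sum.reindex_bij_betw[OF \<nu>])
    then show "lin_comb E ?n b (\<lambda>i\<in>{..<?n}. v (\<nu> i)) e = v e"
      using that by (auto simp: lin_comb_def b_def K_iff PiE_iff extensional_def)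
  qed
  have "bij_betw (lin_comb E ?n b) ({..<?n} \<rightarrow>\<^sub>E UNIV) K"
  proof (rule bij_betw_byWitness[where f' = "\<lambda>v. \<lambda>i\<in>{..<?n}. v (\<nu> i)"])
    show "\<forall>t\<in>{..<?n} \<rightarrow>\<^sub>E UNIV. (\<lambda>i\<in>{..<?n}. lin_comb E ?n b t (\<nu> i)) = t"
      by (auto simp: fun_eq_iff coord PiE_iff extensional_def)
    show "(\<lambda>v. \<lambda>i\<in>{..<?n}. v (\<nu> i)) ` K \<subseteq> {..<?n} \<rightarrow>\<^sub>E UNIV"
      by (intro image_subsetI) (simp add: restrict_PiE_iff)
  qed (use inK inv in auto)
  moreover have "lin_comb E ?n b ` ({..<?n} \<rightarrow>\<^sub>E \<int>) = K \<inter> (E \<rightarrow>\<^sub>E \<int>)"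
  proof
    show "lin_comb E ?n b ` ({..<?n} \<rightarrow>\<^sub>E \<int>) \<subseteq> K \<inter> (E \<rightarrow>\<^sub>E \<int>)"
      using inK u_int by (auto simp: lin_comb_def b_def PiE_iff intro!: Ints_sum Ints_mult)
    show "K \<inter> (E \<rightarrow>\<^sub>E \<int>) \<subseteq> lin_comb E ?n b ` ({..<?n} \<rightarrow>\<^sub>E \<int>)"
    proof
      fix v assume v: "v \<in> K \<inter> (E \<rightarrow>\<^sub>E \<int>)"
      then have "(\<lambda>i\<in>{..<?n}. v (\<nu> i)) \<in> {..<?n} \<rightarrow>\<^sub>E \<int>"
        using \<nu>_N N_subset by (auto simp: PiE_iff)
      then show "v \<in> lin_comb E ?n b ` ({..<?n} \<rightarrow>\<^sub>E \<int>)" using inv v by (metis IntD1 imageI)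
    qed
  qed
  ultimately show ?thesis unfolding lattice_basis_def by blast
qed

text \<open>The basis here is arbitrary, since the one picked by \<open>SOME\<close> is not known
  explicitly. Expressing the vectors \<open>u f\<close> in it shows that the coordinates
  \<open>t\<close> are linear functions of the entries on \<open>N\<close>, which later bounds
  them.\<close>

lemma lattice_basis_coordinates:
  assumes "lattice_basis E K k b"
  obtains l where "\<And>t i. i < k \<Longrightarrow> t i = (\<Sum>f\<in>N. l i f * (\<Sum>j<k. t j * b j f))"
    and "k = card N"
proof -
  have bij: "bij_betw (lin_comb E k b) ({..<k} \<rightarrow>\<^sub>E UNIV) K" using assms by (simp add: lattice_basis_def)
  have "\<exists>s\<in>{..<k} \<rightarrow>\<^sub>E UNIV. lin_comb E k b s = (\<lambda>e\<in>E. u f e)" if "f \<in> N" for f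
  proof -
    have "(\<Sum>g\<in>N. of_bool (g = f) * u g e) = u f e" for e
      using that finite_N by simp
    then have "(\<lambda>e\<in>E. u f e) \<in> K"
      using combination_in_K(1)[OF refl, of "\<lambda>g. of_bool (g = f)"] by simp
    then show ?thesis using bij unfolding bij_betw_def by (metis imageE)
  qed
  then obtain s where s: "\<And>f. f \<in> N \<Longrightarrow> lin_comb E k b (s f) = (\<lambda>e\<in>E. u f e)" by metis
  have s_eq: "(\<Sum>i<k. s f i * b i e) = u f e" if "f \<in> N" "e \<in> E" for f e
    using fun_cong[OF s[OF that(1)], of e] that(2) by (simp add: lin_comb_def)
  define l where "l = (\<lambda>i f. s f i)"
  have l: "t i = (\<Sum>f\<in>N. l i f * (\<Sum>j<k. t j * b j f))" if "i < k" for t i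
  proof -
    define v where "v = lin_comb E k b (restrict t {..<k})"
    have "restrict t {..<k} \<in> {..<k} \<rightarrow>\<^sub>E UNIV" by simp
    then have "v \<in> K" using bij unfolding v_def bij_betw_def by blast
    define t' where "t' = (\<lambda>i\<in>{..<k}. \<Sum>f\<in>N. l i f * v f)"
    have "lin_comb E k b t' = v"
    proof
      fix e
      show "lin_comb E k b t' e = v e"
      proof (cases "e \<in> E")
        case True
        have "lin_comb E k b t' e = (\<Sum>i<k. \<Sum>f\<in>N. v f * (s f i * b i e))"
          using True by (simp add: lin_comb_def t'_def l_def sum_distrib_left sum_distrib_right mult_ac)
        also have "\<dots> = (\<Sum>f\<in>N. v f * (\<Sum>i<k. s f i * b i e))"
          by (subst sum.swap) (simp add: sum_distrib_left)
        also have "\<dots> = (\<Sum>f\<in>N. v f * u f e)" using True by (simp add: s_eq)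
        also have "\<dots> = v e" using \<open>v \<in> K\<close> True by (simp add: K_iff)
        finally show ?thesis .
      next
        case False
        then show ?thesis by (simp add: v_def lin_comb_def)
      qed
    qed
    moreover have "t' \<in> {..<k} \<rightarrow>\<^sub>E UNIV" by (simp add: t'_def)
    moreover have "inj_on (lin_comb E k b) ({..<k} \<rightarrow>\<^sub>E UNIV)" using bij by (simp add: bij_betw_def)
    ultimately have "t' = restrict t {..<k}"
      by (simp only: v_def) (erule (1) inj_onD, simp_all)
    then have "t i = t' i" using that by simp
    also have "\<dots> = (\<Sum>f\<in>N. l i f * (\<Sum>j<k. t j * b j f))"
      using that N_subset by (auto simp: t'_def v_def lin_comb_def intro!: sum.cong)
    finally show ?thesis .
  qed
  have diag: "1 = (\<Sum>f\<in>N. l i f * b i f)" if "i < k" for i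
    using l[OF that, of "\<lambda>j. of_bool (j = i)"] that by simp
  \<comment> \<open>Comparison of traces: the matrices of \<open>l\<close> and of \<open>b\<close>
    on \<open>N\<close> are inverse to each other in both orders, so the identity matrices have the
    same trace.\<close>
  have "real k = (\<Sum>i<k. 1)" by simp
  also have "\<dots> = (\<Sum>i<k. \<Sum>f\<in>N. l i f * b i f)" by (intro sum.cong refl diag) simp
  also have "\<dots> = (\<Sum>f\<in>N. \<Sum>i<k. s f i * b i f)" unfolding l_def by (rule sum.swap)
  also have "\<dots> = (\<Sum>f\<in>N. 1)" using N_subset by (intro sum.cong) (auto simp: s_eq u_N)
  finally have "k = card N" by simp
  with l show ?thesis by (rule that)
qed

end

text \<open>The base point picked by \<open>SOME\<close> differs from \<open>a\<close> by an element
  of \<open>K\<close>, and the volume is translation invariant. The point \<open>a\<close> may lie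
  outside \<open>A\<close>, which leaves room to choose it linearly in the lengths.\<close>

lemma lattice_volume_eq_slice_volume:
  assumes "finite E" and basis: "lattice_basis E K k b" and some: "(SOME (k, b). lattice_basis E K k b) = (k, b)"
    and A: "\<And>m. m \<in> A \<longleftrightarrow> m \<in> E \<rightarrow>\<^sub>E {0<..} \<and> (\<lambda>e\<in>E. m e - a e) \<in> K"
  shows "lattice_volume E K A = slice_volume E k b a"
proof -
  let ?M = "PiM {..<k} (\<lambda>_. lborel :: real measure)"
  have K: "K = lin_comb E k b ` ({..<k} \<rightarrow>\<^sub>E UNIV)" using basis by (simp add: lattice_basis_def bij_betw_def)
  have in_K: "lin_comb E k b t \<in> K" for t
  proof -
    have "lin_comb E k b t = lin_comb E k b (restrict t {..<k})" by (simp add: lin_comb_def)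
    then show ?thesis unfolding K by auto
  qed
  have A': "(\<lambda>e\<in>E. a e + (\<Sum>i<k. t i * b i e)) \<in> A \<longleftrightarrow> (\<forall>e\<in>E. a e + (\<Sum>i<k. t i * b i e) > 0)" for t
  proof -
    have "(\<lambda>e\<in>E. (\<lambda>e\<in>E. a e + (\<Sum>i<k. t i * b i e)) e - a e) = lin_comb E k b t"
      by (auto simp: lin_comb_def)
    then show ?thesis using in_K[of t] by (auto simp: A)
  qed
  have vol: "lattice_volume E K A
      = measure ?M {t \<in> {..<k} \<rightarrow>\<^sub>E UNIV. (\<lambda>e\<in>E. (SOME a. a \<in> A) e + lin_comb E k b t e) \<in> A}"
    by (simp add: lattice_volume_def some Let_def)
  show ?thesis
  proof (cases "A = {}")
    case True
    have "slice E k b a = {}" using A' True by (auto simp: slice_def)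
    then show ?thesis unfolding vol slice_volume_def by (simp add: True)
  next
    case False
    define m where "m = (SOME a. a \<in> A)"
    have "m \<in> A" using False unfolding m_def by (simp add: some_in_eq)
    then have "(\<lambda>e\<in>E. m e - a e) \<in> K" by (simp add: A)
    then obtain c where c: "(\<lambda>e\<in>E. m e - a e) = lin_comb E k b c" unfolding K by blast
    have m: "m e = a e + (\<Sum>i<k. c i * b i e)" if "e \<in> E" for e
      using fun_cong[OF c, of e] that by (simp add: lin_comb_def)
    have "(\<lambda>e\<in>E. m e + lin_comb E k b t e) \<in> A
        \<longleftrightarrow> (\<forall>e\<in>E. a e + (\<Sum>i<k. c i * b i e) + (\<Sum>i<k. t i * b i e) > 0)" for t
    proof -
      have "(\<lambda>e\<in>E. m e + lin_comb E k b t e) = (\<lambda>e\<in>E. a e + (\<Sum>i<k. (c i + t i) * b i e))"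
        by (auto simp: m lin_comb_def distrib_right sum.distrib)
      then show ?thesis using A'[of "\<lambda>i. c i + t i"] by (simp add: distrib_right sum.distrib add.assoc)
    qed
    then have "{t \<in> {..<k} \<rightarrow>\<^sub>E UNIV. (\<lambda>e\<in>E. m e + lin_comb E k b t e) \<in> A}
        = slice E k b (\<lambda>e. a e + (\<Sum>i<k. c i * b i e))"
      by (simp add: slice_def)
    then have "lattice_volume E K A = slice_volume E k b (\<lambda>e. a e + (\<Sum>i<k. c i * b i e))"
      unfolding vol m_def[symmetric] by (simp add: slice_volume_def)
    then show ?thesis using slice_volume_translation[OF assms(1)] by simp
  qed
qed

section \<open>Four-valent directed ribbon graphs\<close>

lemma orbit_eq_iff:
  assumes "finite X" "f permutes X"
  shows "orbit f x = orbit f y \<longleftrightarrow> x \<in> orbit f y"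
proof -
  have p: "permutation f" using assms permutation_permutes by blast
  show ?thesis
    using permutation_self_in_orbit[OF p, of x] orbit_cyclic_eq3[OF cyclic_on_orbit[OF assms(2,1)], of x y]
    by auto
qed

lemma funpow_card_orbit:
  assumes "x \<in> orbit f x" shows "(f ^^ card (orbit f x)) x = x"
proof -
  have "card (orbit f x) = funpow_dist1 f x x"
    using card_image[OF inj_on_funpow_dist1[OF assms]] unfolding orbit_conv_funpow_dist1[OF assms, symmetric]
    by simp
  then show ?thesis using funpow_dist1_prop[OF assms] by simp
qed

lemma card_orbits:
  assumes "finite X" "f permutes X" "\<And>x. x \<in> X \<Longrightarrow> card (orbit f x) = k"
  shows "card X = k * card (orbit f ` X)"
proof -
  have p: "permutation f" using assms(1,2) permutation_permutes by blast
  have un: "\<Union>(orbit f ` X) = X"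
    using permutes_orbit_subset[OF assms(2)] permutation_self_in_orbit[OF p] by blast
  have "k * card (orbit f ` X) = card (\<Union>(orbit f ` X))"
  proof (rule card_partition)
    fix c1 c2 assume "c1 \<in> orbit f ` X" "c2 \<in> orbit f ` X" "c1 \<noteq> c2"
    then show "c1 \<inter> c2 = {}" using orbit_eq_iff[OF assms(1,2)] by blast
  qed (use assms un in auto)
  then show ?thesis by (simp add: un)
qed

section \<open>Directions and the bipartite multigraph of boundary components\<close>

locale four_valent_directed_graph =
  fixes R :: "('h, 'p::finite, 'n::finite) directed_ribbon_graph" and g :: nat
  assumes type: "has_type R g" and four: "four_valent R"
begin

abbreviation "X \<equiv> half_edges R"
abbreviation "\<epsilon> \<equiv> dir R"
abbreviation "vertex_at \<equiv> orbit (s0 R)"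
abbreviation "edge_at \<equiv> orbit (s1 R)"
abbreviation "boundary_at \<equiv> orbit (s2 R)"

lemma ribbon: "is_ribbon_graph R" and direction: "is_direction R \<epsilon>" and conn: "connected_graph R"
  and genus: "has_genus R g" and pos_bij: "bij_betw (pos_label R) (pos_boundaries R) UNIV"
  and neg_bij: "bij_betw (neg_label R) (neg_boundaries R) UNIV"
  using type by (auto simp: has_type_def)

lemma finite_X: "finite X" and s0_permutes: "s0 R permutes X" and s1_permutes: "s1 R permutes X"
  and s2_permutes: "s2 R permutes X" and s1_s1: "h \<in> X \<Longrightarrow> s1 R (s1 R h) = h"
  and s1_neq: "h \<in> X \<Longrightarrow> s1 R h \<noteq> h" and s210: "s2 R (s1 R (s0 R h)) = h"
  using ribbon by (auto simp: is_ribbon_graph_def fun_eq_iff)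

lemma s0_in: "s0 R h \<in> X \<longleftrightarrow> h \<in> X" and s1_in: "s1 R h \<in> X \<longleftrightarrow> h \<in> X" and s2_in: "s2 R h \<in> X \<longleftrightarrow> h \<in> X"
  using s0_permutes s1_permutes s2_permutes by (auto simp: permutes_in_image)

lemma \<epsilon>_cases: "h \<in> X \<Longrightarrow> \<epsilon> h = 1 \<or> \<epsilon> h = -1" and \<epsilon>_s2: "h \<in> X \<Longrightarrow> \<epsilon> (s2 R h) = \<epsilon> h"
  and \<epsilon>_s1: "h \<in> X \<Longrightarrow> \<epsilon> (s1 R h) = - \<epsilon> h"
  using direction by (auto simp: is_direction_def)

text \<open>As \<open>s2 \<circ> s1 \<circ> s0\<close> is the identity, \<open>s2\<close> preserves
  directions and \<open>s1\<close> reverses them, directions must alternate around each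
  vertex.\<close>

lemma \<epsilon>_s0: assumes "h \<in> X" shows "\<epsilon> (s0 R h) = - \<epsilon> h"
proof -
  have "\<epsilon> h = \<epsilon> (s2 R (s1 R (s0 R h)))" by (simp add: s210)
  also have "\<dots> = - \<epsilon> (s0 R h)" using assms by (simp add: \<epsilon>_s2 \<epsilon>_s1 s0_in s1_in)
  finally show ?thesis by simp
qed

lemma self_in_vertex: "h \<in> vertex_at h" and self_in_edge: "h \<in> edge_at h"
  and self_in_boundary: "h \<in> boundary_at h"
  using finite_X s0_permutes s1_permutes s2_permutes
  by (auto intro!: permutation_self_in_orbit simp: permutation_permutes)

lemma edge_at_eq_iff: "edge_at x = edge_at y \<longleftrightarrow> x \<in> edge_at y"
  and boundary_at_eq_iff: "boundary_at x = boundary_at y \<longleftrightarrow> x \<in> boundary_at y"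
  using orbit_eq_iff[OF finite_X] s1_permutes s2_permutes by blast+

lemma boundary_at_s2: "boundary_at (s2 R h) = boundary_at h"
  by (simp add: boundary_at_eq_iff orbit.base)

lemma boundary_at_s1_s0: "boundary_at (s1 R (s0 R h)) = boundary_at h"
  using boundary_at_s2[of "s1 R (s0 R h)"] by (simp add: s210)

lemma edge_at: assumes "h \<in> X" shows "edge_at h = {h, s1 R h}"
proof
  show "edge_at h \<subseteq> {h, s1 R h}"
  proof
    fix x assume "x \<in> edge_at h"
    then show "x \<in> {h, s1 R h}" by induction (use s1_s1[OF assms] in auto)
  qed
  show "{h, s1 R h} \<subseteq> edge_at h" using self_in_edge by (auto intro: orbit.base)
qed

lemma edge_at_s1: "edge_at (s1 R h) = edge_at h"
  by (simp add: edge_at_eq_iff orbit.base)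

lemma \<epsilon>_boundary:
  assumes "x \<in> boundary_at h" "h \<in> X" shows "\<epsilon> x = \<epsilon> h"
proof -
  have "x \<in> X \<and> \<epsilon> x = \<epsilon> h"
    using assms(1) by induction (use assms(2) in \<open>auto simp: s2_in \<epsilon>_s2\<close>)
  then show ?thesis ..
qed

lemma boundary_at_pos_iff: "h \<in> X \<Longrightarrow> boundary_at h \<in> pos_boundaries R \<longleftrightarrow> \<epsilon> h = 1"
  and boundary_at_neg_iff: "h \<in> X \<Longrightarrow> boundary_at h \<in> neg_boundaries R \<longleftrightarrow> \<epsilon> h = -1"
  using \<epsilon>_boundary self_in_boundary by (auto simp: pos_boundaries_def neg_boundaries_def boundaries_def)

lemma boundaries_split: "boundaries R = pos_boundaries R \<union> neg_boundaries R"
  "pos_boundaries R \<inter> neg_boundaries R = {}"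
proof -
  show "boundaries R = pos_boundaries R \<union> neg_boundaries R"
  proof
    show "boundaries R \<subseteq> pos_boundaries R \<union> neg_boundaries R"
    proof
      fix \<beta> assume "\<beta> \<in> boundaries R"
      then obtain h where h: "h \<in> X" "\<beta> = boundary_at h" by (auto simp: boundaries_def)
      then show "\<beta> \<in> pos_boundaries R \<union> neg_boundaries R"
        using \<epsilon>_cases[OF h(1)] by (simp add: boundary_at_pos_iff boundary_at_neg_iff)
    qed
  qed (simp add: pos_boundaries_def neg_boundaries_def)
  show "pos_boundaries R \<inter> neg_boundaries R = {}"
  proof (rule ccontr)
    assume "\<not> ?thesis"
    then obtain \<beta> where "\<beta> \<in> pos_boundaries R" "\<beta> \<in> neg_boundaries R" by blast
    moreover from this obtain h where "h \<in> X" "\<beta> = boundary_at h"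
      by (auto simp: pos_boundaries_def boundaries_def)
    ultimately show False using boundary_at_pos_iff boundary_at_neg_iff by simp
  qed
qed

lemma finite_edges: "finite (edges R)" and finite_boundaries: "finite (boundaries R)"
  using finite_X by (simp_all add: edges_def boundaries_def)

lemma edgeE:
  assumes "e \<in> edges R"
  obtains h where "h \<in> X" "\<epsilon> h = 1" "e = edge_at h"
proof -
  from assms obtain h where h: "h \<in> X" "e = edge_at h" by (auto simp: edges_def)
  show ?thesis
  proof (cases "\<epsilon> h = 1")
    case False
    then have "\<epsilon> (s1 R h) = 1" using \<epsilon>_cases[OF h(1)] \<epsilon>_s1[OF h(1)] by simp
    then show ?thesis using h by (intro that[of "s1 R h"]) (auto simp: s1_in edge_at_s1)
  qed (use h that in blast)
qed

text \<open>Since \<open>s1\<close> reverses directions, an edge has exactly one half-edge of each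
  sign, so the description is definite on edges. Together with \<open>neg_end\<close> it gives the
  ends in the bipartite multigraph.\<close>

definition pos_end :: "'h set \<Rightarrow> 'h set" where
  "pos_end e = boundary_at (THE h. h \<in> e \<and> \<epsilon> h = 1)"

definition neg_end :: "'h set \<Rightarrow> 'h set" where
  "neg_end e = boundary_at (THE h. h \<in> e \<and> \<epsilon> h = -1)"

lemma ends:
  assumes "h \<in> X" "\<epsilon> h = 1"
  shows "pos_end (edge_at h) = boundary_at h" "neg_end (edge_at h) = boundary_at (s1 R h)"
proof -
  have "\<epsilon> (s1 R h) = -1" using assms \<epsilon>_s1 by simp
  then have "(THE x. x \<in> edge_at h \<and> \<epsilon> x = 1) = h" "(THE x. x \<in> edge_at h \<and> \<epsilon> x = -1) = s1 R h"
    using assms by (auto simp: edge_at intro!: the_equality)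
  then show "pos_end (edge_at h) = boundary_at h" "neg_end (edge_at h) = boundary_at (s1 R h)"
    by (simp_all add: pos_end_def neg_end_def)
qed

text \<open>If a proper nonempty set \<open>S\<close> of boundary components were not joined to its complement by an
  edge, the half-edges with boundary component in \<open>S\<close> would be stable under \<open>s1\<close> and \<open>s2\<close>, hence
  under \<open>s0\<close>.\<close>

lemma cut_edge:
  assumes "S \<subseteq> boundaries R" "S \<noteq> {}" "S \<noteq> boundaries R"
  shows "\<exists>e\<in>edges R. (pos_end e \<in> S) \<noteq> (neg_end e \<in> S)"
proof (rule ccontr)
  assume "\<not> ?thesis"
  then have no_cut: "pos_end e \<in> S \<longleftrightarrow> neg_end e \<in> S" if "e \<in> edges R" for e using that by blast
  have s1: "boundary_at (s1 R h) \<in> S \<longleftrightarrow> boundary_at h \<in> S" if h: "h \<in> X" for h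
  proof (cases "\<epsilon> h = 1")
    case True
    with ends[OF h True] no_cut[of "edge_at h"] h show ?thesis by (simp add: edges_def)
  next
    case False
    then have "\<epsilon> (s1 R h) = 1" using \<epsilon>_cases[OF h] \<epsilon>_s1[OF h] by simp
    with ends[of "s1 R h"] no_cut[of "edge_at (s1 R h)"] h show ?thesis
      by (simp add: edges_def s1_s1 s1_in)
  qed
  have s0: "boundary_at (s0 R h) \<in> S \<longleftrightarrow> boundary_at h \<in> S" if h: "h \<in> X" for h
    using s1[of "s0 R h"] h by (simp add: s0_in boundary_at_s1_s0)
  have step: "s h \<in> X \<and> (boundary_at (s h) \<in> S \<longleftrightarrow> boundary_at h \<in> S)"
    if "s \<in> {s0 R, s1 R, s2 R}" "h \<in> X" for s h
    using that s0 s1 by (auto simp: s0_in s1_in s2_in boundary_at_s2)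
  have perm: "s permutes X" if "s \<in> {s0 R, s1 R, s2 R}" for s
    using that s0_permutes s1_permutes s2_permutes by blast
  have group: "f h \<in> X \<and> (boundary_at (f h) \<in> S \<longleftrightarrow> boundary_at h \<in> S)"
    if "f \<in> perm_group R" "h \<in> X" for f h
    using that(1)
  proof induction
    case (mult f s)
    then show ?case using step by auto
  next
    case (mult_inv f s)
    have "inv s (f h) \<in> X" using perm[OF mult_inv(2)] mult_inv(3) permutes_inv permutes_in_image by metis
    moreover have "s (inv s (f h)) = f h" using perm[OF mult_inv(2)] by (simp add: permutes_inverses)
    ultimately show ?case using step[OF mult_inv(2), of "inv s (f h)"] mult_inv(3) by simp
  qed (use that(2) in simp)
  from assms obtain \<beta> \<gamma> where "\<beta> \<in> S" "\<beta> \<in> boundaries R" "\<gamma> \<in> boundaries R" "\<gamma> \<notin> S" by blast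
  then obtain x y where "x \<in> X" "boundary_at x \<in> S" "y \<in> X" "boundary_at y \<notin> S"
    by (auto simp: boundaries_def)
  moreover from this obtain f where "f \<in> perm_group R" "f x = y"
    using conn unfolding connected_graph_def by blast
  ultimately show False using group by blast
qed

sublocale finite_connected_multigraph "edges R" "boundaries R" pos_end neg_end
proof
  show "boundaries R \<noteq> {}" using conn by (auto simp: connected_graph_def boundaries_def)
  show "pos_end e \<in> boundaries R" "neg_end e \<in> boundaries R" if "e \<in> edges R" for e
    using that by (auto elim!: edgeE simp: ends boundaries_def s1_in)
qed (use finite_edges finite_boundaries cut_edge in auto)

section \<open>Metrics as positive flows\<close>

definition sign :: "'h set \<Rightarrow> real" where
  "sign \<beta> = (if \<beta> \<in> pos_boundaries R then 1 else -1)"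

lemma sign_boundary_at: "h \<in> X \<Longrightarrow> sign (boundary_at h) = \<epsilon> h"
  using \<epsilon>_cases[of h] by (auto simp: sign_def boundary_at_pos_iff)

text \<open>Each edge is listed once by its positive half-edge, and \<open>s1\<close> supplies the
  negative one. All half-edges of a boundary component have the same sign, so the net flow there is
  the length up to this sign.\<close>

lemma sum_inc_eq_boundary_length:
  assumes "\<beta> \<in> boundaries R"
  shows "(\<Sum>e\<in>edges R. inc e \<beta> * m e) = sign \<beta> * boundary_length R m \<beta>"
proof -
  let ?P = "{h \<in> X. \<epsilon> h = 1}" and ?N = "{h \<in> X. \<epsilon> h = -1}"
  let ?t = "\<lambda>h. of_bool (boundary_at h = \<beta>) * m (edge_at h)"
  have inj: "bij_betw edge_at ?P (edges R)"
  proof (rule bij_betw_imageI)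
    show "inj_on edge_at ?P"
    proof (rule inj_onI)
      fix x y assume xy: "x \<in> ?P" "y \<in> ?P" "edge_at x = edge_at y"
      then have "x \<in> {y, s1 R y}" using edge_at_eq_iff[of x y] edge_at[of y] by auto
      then show "x = y" using xy \<epsilon>_s1[of y] by auto
    qed
    show "edge_at ` ?P = edges R"
    proof
      show "edges R \<subseteq> edge_at ` ?P" by (blast elim: edgeE)
    qed (auto simp: edges_def)
  qed
  have s1_bij: "bij_betw (s1 R) ?P ?N"
    by (rule bij_betw_byWitness[where f' = "s1 R"]) (auto simp: s1_s1 s1_in \<epsilon>_s1)
  have "(\<Sum>e\<in>edges R. inc e \<beta> * m e) = (\<Sum>h\<in>?P. inc (edge_at h) \<beta> * m (edge_at h))"
    by (rule sum.reindex_bij_betw[OF inj, symmetric])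
  also have "\<dots> = (\<Sum>h\<in>?P. ?t h - ?t (s1 R h))"
    by (intro sum.cong refl) (auto simp: inc_def ends edge_at_s1 left_diff_distrib)
  also have "\<dots> = (\<Sum>h\<in>?P. ?t h) - (\<Sum>h\<in>?N. ?t h)"
    by (simp only: sum_subtractf sum.reindex_bij_betw[OF s1_bij, of ?t])
  also have "(\<Sum>h\<in>?P. ?t h) = (\<Sum>h\<in>?P. \<epsilon> h * ?t h)" by (intro sum.cong) auto
  also have "(\<Sum>h\<in>?N. ?t h) = - (\<Sum>h\<in>?N. \<epsilon> h * ?t h)" by (simp add: sum_negf)
  also have "(\<Sum>h\<in>?P. \<epsilon> h * ?t h) - - (\<Sum>h\<in>?N. \<epsilon> h * ?t h) = (\<Sum>h\<in>?P \<union> ?N. \<epsilon> h * ?t h)"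
    using finite_X by (subst sum.union_disjoint) auto
  also have "?P \<union> ?N = X" using \<epsilon>_cases by auto
  also have "(\<Sum>h\<in>X. \<epsilon> h * ?t h) = (\<Sum>h | h \<in> X \<and> boundary_at h = \<beta>. sign \<beta> * m (edge_at h))"
    using finite_X by (intro sum.mono_neutral_cong_right) (auto simp: sign_boundary_at)
  finally show ?thesis by (simp add: boundary_length_def sum_distrib_left)
qed

text \<open>The demand at each node of the flow problem. The sign on negative components turns
  equality of the total lengths into the vanishing of the total demand.\<close>

definition target :: "(real ^ 'p) \<times> (real ^ 'n) \<Rightarrow> 'h set \<Rightarrow> real" where
  "target L \<beta> = (if \<beta> \<in> pos_boundaries R then fst L $ pos_label R \<beta> else - (snd L $ neg_label R \<beta>))"

lemma linear_target: "linear (\<lambda>L. target L \<beta>)"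
  by (auto simp: linear_iff target_def)

lemma sum_target: assumes "L \<in> length_space" shows "sum (target L) (boundaries R) = 0"
proof -
  have "sum (target L) (boundaries R) = sum (target L) (pos_boundaries R) + sum (target L) (neg_boundaries R)"
    unfolding boundaries_split(1) using finite_boundaries boundaries_split
    by (intro sum.union_disjoint) auto
  also have "sum (target L) (pos_boundaries R) = (\<Sum>\<beta>\<in>pos_boundaries R. fst L $ pos_label R \<beta>)"
    by (simp add: target_def)
  also have "\<dots> = (\<Sum>i\<in>UNIV. fst L $ i)" by (rule sum.reindex_bij_betw[OF pos_bij])
  also have "sum (target L) (neg_boundaries R) = (\<Sum>\<beta>\<in>neg_boundaries R. - (snd L $ neg_label R \<beta>))"
    using boundaries_split(2) by (intro sum.cong) (auto simp: target_def)
  also have "\<dots> = (\<Sum>i\<in>UNIV. - (snd L $ i))" by (rule sum.reindex_bij_betw[OF neg_bij])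
  finally show ?thesis using assms by (simp add: length_space_def sum_negf)
qed

lemma Met_iff:
  "m \<in> Met R L \<longleftrightarrow> m \<in> edges R \<rightarrow>\<^sub>E {0<..} \<and> (\<forall>\<beta>\<in>boundaries R. (\<Sum>e\<in>edges R. inc e \<beta> * m e) = target L \<beta>)"
proof -
  have "(\<forall>\<beta>\<in>boundaries R. (\<Sum>e\<in>edges R. inc e \<beta> * m e) = target L \<beta>)
      \<longleftrightarrow> (\<forall>\<beta>\<in>pos_boundaries R \<union> neg_boundaries R. sign \<beta> * boundary_length R m \<beta> = target L \<beta>)"
    using sum_inc_eq_boundary_length boundaries_split(1) by auto
  also have "\<dots> \<longleftrightarrow> (\<forall>\<beta>\<in>pos_boundaries R. boundary_length R m \<beta> = fst L $ pos_label R \<beta>) \<and>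
     (\<forall>\<beta>\<in>neg_boundaries R. boundary_length R m \<beta> = snd L $ neg_label R \<beta>)"
    using boundaries_split(2) unfolding ball_Un
    by (intro conj_cong ball_cong refl) (auto simp: sign_def target_def)
  finally show ?thesis by (auto simp: Met_def)
qed

lemma boundary_kernel_iff:
  "v \<in> boundary_kernel R \<longleftrightarrow> v \<in> edges R \<rightarrow>\<^sub>E UNIV \<and> (\<forall>\<beta>\<in>boundaries R. (\<Sum>e\<in>edges R. inc e \<beta> * v e) = 0)"
  by (auto simp: boundary_kernel_def sum_inc_eq_boundary_length sign_def)

text \<open>A half-edge \<open>h\<close> at the vertex contributes its sign to the components of
  \<open>h\<close> and of \<open>s1 R h\<close>. The second component of \<open>s0 R h\<close> is
  the first one of \<open>h\<close>, and the signs are opposite, so everything cancels around the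
  vertex.\<close>

lemma vertex_sum_in_boundary_kernel:
  assumes "x \<in> X"
  defines "v \<equiv> \<lambda>e\<in>edges R. \<Sum>h\<in>vertex_at x. of_bool (edge_at h = e) * real_of_int (\<epsilon> h)"
  shows "v \<in> boundary_kernel R"
  unfolding boundary_kernel_def
proof (intro CollectI conjI ballI)
  show "v \<in> edges R \<rightarrow>\<^sub>E UNIV" by (simp add: v_def)
  fix \<beta> assume "\<beta> \<in> boundaries R"
  let ?V = "vertex_at x" and ?I = "\<lambda>h. of_bool (boundary_at h = \<beta>) :: real"
  have V: "?V \<subseteq> X" using permutes_orbit_subset[OF s0_permutes assms(1)] .
  have "boundary_length R v \<beta>
      = (\<Sum>h' | h' \<in> X \<and> boundary_at h' = \<beta>. \<Sum>h\<in>?V. of_bool (edge_at h = edge_at h') * real_of_int (\<epsilon> h))"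
    unfolding boundary_length_def by (intro sum.cong refl) (auto simp: v_def edges_def)
  also have "\<dots> = (\<Sum>h\<in>?V. \<Sum>h' | h' \<in> X \<and> boundary_at h' = \<beta>. of_bool (edge_at h = edge_at h') * real_of_int (\<epsilon> h))"
    by (rule sum.swap)
  also have "\<dots> = (\<Sum>h\<in>?V. \<epsilon> h * ?I h + \<epsilon> h * ?I (s1 R h))"
  proof (rule sum.cong[OF refl])
    fix h assume "h \<in> ?V"
    then have h: "h \<in> X" using V by blast
    have "(\<Sum>h' | h' \<in> X \<and> boundary_at h' = \<beta>. of_bool (edge_at h = edge_at h') * real_of_int (\<epsilon> h))
        = (\<Sum>h'\<in>{h, s1 R h}. \<epsilon> h * ?I h')"
    proof -
      have "(\<Sum>h' | h' \<in> X \<and> boundary_at h' = \<beta>. of_bool (edge_at h = edge_at h') * real_of_int (\<epsilon> h))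
          = (\<Sum>h'\<in>X. of_bool (edge_at h = edge_at h') * (\<epsilon> h * ?I h'))"
        using finite_X by (intro sum.mono_neutral_cong_left) auto
      also have "\<dots> = (\<Sum>h'\<in>{h, s1 R h}. \<epsilon> h * ?I h')"
      proof (rule sum.mono_neutral_cong_right[OF finite_X])
        show "{h, s1 R h} \<subseteq> X" using h by (simp add: s1_in)
        show "\<forall>h'\<in>X - {h, s1 R h}. of_bool (edge_at h = edge_at h') * (\<epsilon> h * ?I h') = 0"
        proof
          fix h' assume "h' \<in> X - {h, s1 R h}"
          then have "edge_at h' \<noteq> edge_at h"
            unfolding edge_at_eq_iff[of h' h] by (simp add: edge_at[OF h])
          then show "of_bool (edge_at h = edge_at h') * (\<epsilon> h * ?I h') = 0" by simp
        qed
      qed (auto simp: edge_at_s1)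
      finally show ?thesis .
    qed
    then show "(\<Sum>h' | h' \<in> X \<and> boundary_at h' = \<beta>. of_bool (edge_at h = edge_at h') * real_of_int (\<epsilon> h))
        = \<epsilon> h * ?I h + \<epsilon> h * ?I (s1 R h)"
      using s1_neq[OF h] by simp
  qed
  also have "\<dots> = (\<Sum>h\<in>?V. \<epsilon> h * ?I h) + (\<Sum>h\<in>?V. \<epsilon> h * ?I (s1 R h))"
    by (rule sum.distrib)
  \<comment> \<open>Rotating the vertex by \<open>s0\<close> pairs the second contribution of each
    half-edge with the first contribution of its predecessor.\<close>
  also have "(\<Sum>h\<in>?V. \<epsilon> h * ?I (s1 R h)) = (\<Sum>h\<in>?V. \<epsilon> (s0 R h) * ?I (s1 R (s0 R h)))"
  proof (rule sum.reindex_bij_betw[symmetric])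
    show "bij_betw (s0 R) ?V ?V"
      using cyclic_on_orbit[OF s0_permutes finite_X] permutes_inj_on[OF s0_permutes]
      by (metis bij_betw_imageI cyclic_on_f_in finite_X finite_subset V endo_inj_surj image_subsetI cyclic_on_inI)
  qed
  also have "\<dots> = (\<Sum>h\<in>?V. - (\<epsilon> h * ?I h))"
    using V by (intro sum.cong refl) (auto simp: \<epsilon>_s0 boundary_at_s1_s0)
  finally show "boundary_length R v \<beta> = 0" by (simp add: sum_negf)
qed

text \<open>An edge on which all of \<open>K\<^sub>R\<close> vanishes has both ends at one vertex by the previous lemma; as
  directions alternate around a vertex of degree \<open>4\<close>, the ends are neighbours there and cut off a
  boundary component consisting of a single half-edge.\<close>

lemma bridge_fixed_point:
  assumes "x \<in> X" "\<And>v. v \<in> boundary_kernel R \<Longrightarrow> v (edge_at x) = 0"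
  obtains h where "h \<in> X" "edge_at h = edge_at x" "s2 R h = h"
proof -
  let ?V = "vertex_at x"
  have V: "?V \<subseteq> X" using permutes_orbit_subset[OF s0_permutes assms(1)] .
  have finV: "finite ?V" using V finite_X finite_subset by blast
  have "0 = (\<Sum>h\<in>?V. of_bool (edge_at h = edge_at x) * real_of_int (\<epsilon> h))"
    using assms(2)[OF vertex_sum_in_boundary_kernel[OF assms(1)]] assms(1) by (simp add: edges_def)
  also have "\<dots> = (\<Sum>h\<in>?V \<inter> {x, s1 R x}. real_of_int (\<epsilon> h))"
  proof (rule sum.mono_neutral_cong_right[OF finV])
    have same_edge: "edge_at h = edge_at x \<longleftrightarrow> h \<in> {x, s1 R x}" for h
      unfolding edge_at_eq_iff[of h x] by (simp only: edge_at[OF assms(1)])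
    show "\<forall>h\<in>?V - ?V \<inter> {x, s1 R x}. of_bool (edge_at h = edge_at x) * real_of_int (\<epsilon> h) = 0"
      unfolding same_edge by auto
    show "of_bool (edge_at h = edge_at x) * real_of_int (\<epsilon> h) = \<epsilon> h" if "h \<in> ?V \<inter> {x, s1 R x}" for h
      unfolding same_edge using that by auto
  qed simp
  finally have zero: "(\<Sum>h\<in>?V \<inter> {x, s1 R x}. real_of_int (\<epsilon> h)) = 0" ..
  \<comment> \<open>If only one end of the edge were at this vertex, the alternating sum would be
    \<open>1\<close> or \<open>-1\<close> instead of zero.\<close>
  have s1x: "s1 R x \<in> ?V"
  proof (rule ccontr)
    assume "s1 R x \<notin> ?V"
    then have "?V \<inter> {x, s1 R x} = {x}" using self_in_vertex by auto
    then show False using zero \<epsilon>_cases[OF assms(1)] by auto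
  qed
  have "card ?V = 4" using four assms(1) by (simp add: four_valent_def vertices_def)
  have period: "(s0 R ^^ 4) x = x"
  proof -
    have "(s0 R ^^ card ?V) x = x" using self_in_vertex by (rule funpow_card_orbit)
    then show ?thesis using \<open>card ?V = 4\<close> by simp
  qed
  have "s1 R x \<in> {x, s0 R x, s0 R (s0 R x), s0 R (s0 R (s0 R x))}"
    using s1x unfolding orbit_altdef_bounded[OF period, simplified]
    by (auto simp: numeral_eq_Suc less_Suc_eq)
  \<comment> \<open>By alternation, opposite directions leave only the positions one and three steps
    from \<open>x\<close>.\<close>
  moreover have "\<epsilon> (s1 R x) \<noteq> \<epsilon> x" using \<epsilon>_s1[OF assms(1)] \<epsilon>_cases[OF assms(1)] by auto
  ultimately consider "s1 R x = s0 R x" | "s1 R x = s0 R (s0 R (s0 R x))"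
    using assms(1) by (auto simp: \<epsilon>_s0 s0_in)
  then show ?thesis
  proof cases
    case 1
    then have "s2 R x = x" using s210[of x] s1_s1[OF assms(1)] by simp
    then show ?thesis using assms(1) that by blast
  next
    case 2
    then have "s0 R (s1 R x) = x" using period by (simp add: numeral_eq_Suc)
    then have "s2 R (s1 R x) = s1 R x" using s210[of "s1 R x"] by simp
    then show ?thesis using assms(1) by (intro that[of "s1 R x"]) (auto simp: s1_in edge_at_s1)
  qed
qed

lemma boundary_length_fixed_point:
  assumes "h \<in> X" "s2 R h = h" shows "boundary_length R m (boundary_at h) = m (edge_at h)"
proof -
  have "boundary_at h = {h}" using assms(2) by (simp add: orbit_eq_singleton_iff)
  then have "{x. x \<in> X \<and> boundary_at x = boundary_at h} = {h}"
    using assms(1) self_in_boundary by fastforce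
  then show ?thesis by (simp add: boundary_length_def)
qed

text \<open>Counting half-edges by edges and by vertices gives twice as many edges as vertices;
  Euler's formula then determines both numbers.\<close>

lemma card_edges: "int (card (edges R)) = 4 * int g - 4 + 2 * int (CARD('p) + CARD('n))"
  and card_boundaries: "card (boundaries R) = CARD('p) + CARD('n)"
proof -
  have "card X = 2 * card (edges R)"
    unfolding edges_def using finite_X s1_permutes
    by (rule card_orbits) (simp add: edge_at s1_neq[symmetric])
  moreover have "card X = 4 * card (vertices R)"
    unfolding vertices_def using finite_X s0_permutes
    by (rule card_orbits) (use four in \<open>simp add: four_valent_def vertices_def\<close>)
  moreover show B: "card (boundaries R) = CARD('p) + CARD('n)"
    using bij_betw_same_card[OF pos_bij] bij_betw_same_card[OF neg_bij] boundaries_split finite_boundaries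
    by (simp add: card_Un_disjoint)
  ultimately show "int (card (edges R)) = 4 * int g - 4 + 2 * int (CARD('p) + CARD('n))"
    using genus unfolding has_genus_def by simp
qed

end

section \<open>The volume contributed by one graph\<close>

context four_valent_directed_graph
begin

lemma lattice_volume_Met:
  obtains a k b r where "k = 4 * g + CARD('p) + CARD('n) - 3" "\<And>e. linear (\<lambda>L. a L e)" "linear r"
    "\<And>L. L \<in> length_domain \<Longrightarrow>
      lattice_volume (edges R) (boundary_kernel R) (Met R L) = slice_volume (edges R) k b (a L)"
    "\<And>L t i. L \<in> length_domain \<Longrightarrow> t \<in> slice (edges R) k b (a L) \<Longrightarrow> i < k \<Longrightarrow> \<bar>t i\<bar> < r L"
    "\<And>e L. e \<in> edges R \<Longrightarrow> L \<in> length_domain \<Longrightarrow> \<forall>i<k. b i e = 0 \<Longrightarrow> a L e > 0"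
proof -
  let ?E = "edges R" and ?K = "boundary_kernel R"
  obtain T C c where T: "T \<subseteq> ?E" "card T + 1 = card (boundaries R)" and c: "\<And>e f. c e f \<in> \<int>"
    and sol: "\<And>w x. sum w (boundaries R) = 0 \<Longrightarrow>
      (\<forall>\<beta>\<in>boundaries R. (\<Sum>e\<in>?E. inc e \<beta> * x e) = w \<beta>) \<longleftrightarrow>
      (\<forall>e\<in>T. x e = (\<Sum>\<beta>\<in>boundaries R. C e \<beta> * w \<beta>) + (\<Sum>f\<in>?E - T. c e f * x f))"
    by (rule flow_parametrization) blast
  define N where "N = ?E - T"
  \<comment> \<open>\<open>u f\<close> is the flow without sources that is \<open>1\<close> on
    \<open>f\<close> and zero on the other edges outside the tree; \<open>c\<close> gives its values
    on the tree.\<close>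
  define u where "u = (\<lambda>f e. if e \<in> T then c e f else of_bool (f = e))"
  \<comment> \<open>The solution of the flow equations supported on the tree. It is linear in
    \<open>L\<close> but may take negative values, so in general it is not a metric.\<close>
  define a where "a = (\<lambda>L e. if e \<in> T then \<Sum>\<beta>\<in>boundaries R. C e \<beta> * target L \<beta> else 0)"
  have finN: "finite N" using finite_edges by (simp add: N_def)
  have E_split: "?E = T \<union> N" "T \<inter> N = {}" using T by (auto simp: N_def)
  have K_iff: "v \<in> ?K \<longleftrightarrow> v \<in> ?E \<rightarrow>\<^sub>E UNIV \<and> (\<forall>e\<in>?E. v e = (\<Sum>f\<in>N. v f * u f e))" for v
  proof -
    have N_eq: "\<forall>e\<in>N. v e = (\<Sum>f\<in>N. v f * u f e)"
    proof
      fix e assume e: "e \<in> N"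
      then have "e \<notin> T" using E_split by auto
      then show "v e = (\<Sum>f\<in>N. v f * u f e)" using e finN by (simp add: u_def)
    qed
    have T_eq: "(\<Sum>f\<in>N. c e f * v f) = (\<Sum>f\<in>N. v f * u f e)" if "e \<in> T" for e
      using that by (simp add: u_def mult.commute)
    have "(\<forall>\<beta>\<in>boundaries R. (\<Sum>e\<in>?E. inc e \<beta> * v e) = 0) \<longleftrightarrow> (\<forall>e\<in>T. v e = (\<Sum>f\<in>N. c e f * v f))"
      using sol[of "\<lambda>_. 0" v] by (simp add: N_def)
    also have "\<dots> \<longleftrightarrow> (\<forall>e\<in>T. v e = (\<Sum>f\<in>N. v f * u f e))"
      by (intro ball_cong refl) (simp only: T_eq)
    finally show ?thesis unfolding boundary_kernel_iff E_split(1) ball_Un using N_eq by blast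
  qed
  interpret L: coordinate_lattice ?E N u ?K
  proof
    show "u f e \<in> \<int>" for f e using c by (simp add: u_def)
    show "u f f' = of_bool (f = f')" if "f \<in> N" "f' \<in> N" for f f'
      using that E_split by (auto simp: u_def)
  qed (use finite_edges K_iff N_def in auto)
  obtain k b where kb: "(SOME (k, b). lattice_basis ?E ?K k b) = (k, b)" by fastforce
  have basis: "lattice_basis ?E ?K k b"
  proof -
    have "\<exists>kb. case kb of (k, b) \<Rightarrow> lattice_basis ?E ?K k b" using L.lattice_basis_exists by auto
    then have "case (SOME (k, b). lattice_basis ?E ?K k b) of (k, b) \<Rightarrow> lattice_basis ?E ?K k b"
      by (rule someI_ex)
    then show ?thesis by (simp add: kb)
  qed
  obtain l where l: "\<And>t i. i < k \<Longrightarrow> t i = (\<Sum>f\<in>N. l i f * (\<Sum>j<k. t j * b j f))" and k: "k = card N"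
    using L.lattice_basis_coordinates[OF basis] by blast
  have a_N: "a L e = 0" if "e \<in> N" for L e using that E_split by (auto simp: a_def)
  have solves_iff: "(\<forall>\<beta>\<in>boundaries R. (\<Sum>e\<in>?E. inc e \<beta> * m e) = target L \<beta>)
      \<longleftrightarrow> (\<forall>e\<in>T. m e = a L e + (\<Sum>f\<in>N. c e f * m f))" if "L \<in> length_space" for L m
    unfolding sol[OF sum_target[OF that]] N_def by (simp add: a_def)
  have Met_K: "m \<in> Met R L \<longleftrightarrow> m \<in> ?E \<rightarrow>\<^sub>E {0<..} \<and> (\<lambda>e\<in>?E. m e - a L e) \<in> ?K"
    if "L \<in> length_space" for L m
  proof -
    have "(\<Sum>f\<in>N. c e f * (\<lambda>e\<in>?E. m e - a L e) f) = (\<Sum>f\<in>N. c e f * m f)" for e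
      using E_split by (intro sum.cong refl) (auto simp: a_N)
    then have "(\<lambda>e\<in>?E. m e - a L e) \<in> ?K \<longleftrightarrow> (\<forall>e\<in>T. m e - a L e = (\<Sum>f\<in>N. c e f * m f))"
      using sol[of "\<lambda>_. 0" "\<lambda>e\<in>?E. m e - a L e"] T(1) unfolding boundary_kernel_iff N_def[symmetric]
      by (auto simp: subset_iff)
    also have "\<dots> \<longleftrightarrow> (\<forall>e\<in>T. m e = a L e + (\<Sum>f\<in>N. c e f * m f))"
      by (intro ball_cong refl) (auto simp: algebra_simps)
    finally show ?thesis unfolding Met_iff solves_iff[OF that] by blast
  qed
  have domain_space: "L \<in> length_space" if "L \<in> length_domain" for L :: "(real ^ 'p) \<times> (real ^ 'n)"
    using that by (simp add: length_domain_def length_space_def)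
  have vol: "lattice_volume ?E ?K (Met R L) = slice_volume ?E k b (a L)" if "L \<in> length_domain" for L
    by (rule lattice_volume_eq_slice_volume[OF finite_edges basis kb Met_K[OF domain_space[OF that]]])
  have in_Met: "(\<lambda>e\<in>?E. a L e + (\<Sum>i<k. t i * b i e)) \<in> Met R L"
    if "L \<in> length_domain" "t \<in> slice ?E k b (a L)" for L t
  proof -
    have "(\<lambda>e\<in>?E. (\<lambda>e\<in>?E. a L e + (\<Sum>i<k. t i * b i e)) e - a L e) = lin_comb ?E k b t"
      by (auto simp: lin_comb_def)
    moreover have "lin_comb ?E k b t \<in> ?K"
      using basis that(2) unfolding lattice_basis_def bij_betw_def slice_def by blast
    ultimately show ?thesis
      using that(2) unfolding Met_K[OF domain_space[OF that(1)]] by (auto simp: slice_def)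
  qed
  define S where "S = (\<lambda>L :: (real ^ 'p) \<times> (real ^ 'n). \<Sum>i\<in>UNIV. fst L $ i)"
  have S_pos: "S L > 0" if "L \<in> length_domain" for L
    using that by (auto simp: S_def length_domain_def intro: sum_pos)
  \<comment> \<open>Each edge borders a positive component, and all edge lengths are positive, so
    the length of this component bounds that of the edge.\<close>
  have Met_le: "m e \<le> S L" if "L \<in> length_domain" "m \<in> Met R L" "e \<in> ?E" for L m e
  proof -
    from that(3) obtain h where h: "h \<in> X" "\<epsilon> h = 1" "e = edge_at h" by (rule edgeE)
    have "m (edge_at x) > 0" if "x \<in> X" for x
      using \<open>m \<in> Met R L\<close> that by (auto simp: Met_def edges_def PiE_iff)
    then have "m e \<le> boundary_length R m (boundary_at h)"
      unfolding boundary_length_def h(3) using h finite_X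
      by (intro member_le_sum[where f = "\<lambda>x. m (edge_at x)"]) (auto simp: less_imp_le)
    also have "\<dots> = fst L $ pos_label R (boundary_at h)"
      using that(2) h by (auto simp: Met_def boundary_at_pos_iff)
    also have "\<dots> \<le> S L"
      unfolding S_def using that(1)
      by (intro member_le_sum[where f = "\<lambda>i. fst L $ i"]) (auto simp: length_domain_def less_imp_le)
    finally show ?thesis .
  qed
  \<comment> \<open>On \<open>N\<close> the section \<open>a\<close> vanishes, so there the linear
    combinations of \<open>b\<close> are edge lengths between \<open>0\<close> and
    \<open>S L\<close>. The coefficients \<open>l\<close> carry this over to \<open>t\<close>, and
    the summand \<open>1\<close> makes the bound strict.\<close>
  define M where "M = 1 + (\<Sum>i<k. \<Sum>f\<in>N. \<bar>l i f\<bar>)"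
  have bound: "\<bar>t i\<bar> < M * S L" if L: "L \<in> length_domain" and t: "t \<in> slice ?E k b (a L)" and i: "i < k" for L t i
  proof -
    have f: "\<bar>\<Sum>j<k. t j * b j f\<bar> \<le> S L" if "f \<in> N" for f
    proof -
      have "f \<in> ?E" using that E_split by auto
      moreover have "0 < (\<Sum>j<k. t j * b j f)"
        using t \<open>f \<in> ?E\<close> a_N[OF that, of L] by (auto simp: slice_def)
      moreover have "(\<Sum>j<k. t j * b j f) \<le> S L"
        using Met_le[OF L in_Met[OF L t] \<open>f \<in> ?E\<close>] \<open>f \<in> ?E\<close> a_N[OF that, of L] by simp
      ultimately show ?thesis by simp
    qed
    have "\<bar>t i\<bar> = \<bar>\<Sum>f\<in>N. l i f * (\<Sum>j<k. t j * b j f)\<bar>" using l[OF i, of t] by simp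
    also have "\<dots> \<le> (\<Sum>f\<in>N. \<bar>l i f\<bar> * S L)"
      by (intro order_trans[OF sum_abs] sum_mono) (simp add: abs_mult mult_left_mono f)
    also have "\<dots> = (\<Sum>f\<in>N. \<bar>l i f\<bar>) * S L" by (simp add: sum_distrib_right)
    also have "\<dots> \<le> (\<Sum>i<k. \<Sum>f\<in>N. \<bar>l i f\<bar>) * S L"
      using i S_pos[OF L] by (intro mult_right_mono member_le_sum[where f = "\<lambda>i. \<Sum>f\<in>N. \<bar>l i f\<bar>"])
        (auto intro: sum_nonneg)
    also have "\<dots> < M * S L" using S_pos[OF L] by (simp add: M_def)
    finally show ?thesis .
  qed
  have row: "a L e > 0" if e: "e \<in> ?E" and L: "L \<in> length_domain" and zero: "\<forall>i<k. b i e = 0" for L e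
  proof -
    from e obtain x where x: "x \<in> X" "e = edge_at x" by (auto simp: edges_def)
    have "v e = 0" if "v \<in> ?K" for v
    proof -
      from that basis obtain t where "v = lin_comb ?E k b t"
        unfolding lattice_basis_def bij_betw_def by blast
      then show ?thesis using zero e by (simp add: lin_comb_def)
    qed
    then obtain h where h: "h \<in> X" "edge_at h = e" "s2 R h = h"
      using bridge_fixed_point[OF x(1)] x(2) by metis
    \<comment> \<open>\<open>a L\<close> itself satisfies the flow equations, so its value on an
      edge that bounds a component alone is the prescribed length of that component.\<close>
    have "(\<Sum>f\<in>N. c e' f * a L f) = 0" for e' by (simp add: a_N)
    then have "\<forall>\<beta>\<in>boundaries R. (\<Sum>e\<in>?E. inc e \<beta> * a L e) = target L \<beta>"
      unfolding solves_iff[OF domain_space[OF L]] by simp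
    moreover have \<beta>: "boundary_at h \<in> boundaries R" using h(1) by (simp add: boundaries_def)
    ultimately have "sign (boundary_at h) * a L e = target L (boundary_at h)"
      using sum_inc_eq_boundary_length[OF \<beta>, of "a L"] boundary_length_fixed_point[OF h(1,3), of "a L"] h(2)
      by simp
    then show ?thesis
      using L by (auto simp: sign_def target_def length_domain_def split: if_splits)
  qed
  have "int k = 4 * int g - 3 + int (CARD('p) + CARD('n))"
  proof -
    have "card ?E = card T + card N"
      unfolding E_split(1) using finite_subset[OF T(1) finite_edges] finN E_split(2) by (rule card_Un_disjoint)
    then show ?thesis using card_edges card_boundaries T(2) k by simp
  qed
  \<comment> \<open>The integer equation has the natural number \<open>k\<close> on its left, so the
    subtraction is not truncated.\<close>
  then have "k = 4 * g + CARD('p) + CARD('n) - 3" by simp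
  moreover have "linear (\<lambda>L. a L e)" for e
    using linear_target
    by (auto simp: linear_iff a_def distrib_left sum.distrib sum_distrib_left mult.left_commute)
  moreover have "linear (\<lambda>L. M * S L)"
    by (auto simp: linear_iff S_def distrib_left sum.distrib sum_distrib_left mult.left_commute)
  ultimately show ?thesis using vol bound row by (rule that)
qed

end

section \<open>The sum over isomorphism classes\<close>

lemma four_valent_graphs_representative:
  assumes "C \<in> four_valent_graphs g // iso_rel g"
  shows "four_valent_directed_graph (SOME R. R \<in> C) g"
proof -
  from assms obtain R0 where R0: "R0 \<in> four_valent_graphs g" "C = iso_rel g `` {R0}"
    by (rule quotientE)
  have "is_iso R0 R0 id" by (simp add: is_iso_def)
  then have "R0 \<in> C" using R0 by (auto simp: iso_rel_def)
  then have "(SOME R. R \<in> C) \<in> C" by (rule someI)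
  then have "(SOME R. R \<in> C) \<in> four_valent_graphs g" using R0 by (auto simp: iso_rel_def)
  then show ?thesis by (simp add: four_valent_graphs_def four_valent_directed_graph_def)
qed

text \<open>The number of coordinates depends only on the type, so all graphs contribute functions
  of the same degree, and both properties pass to linear combinations.\<close>

lemma moduli_volume_hpw:
  fixes g :: nat
  defines "V \<equiv> moduli_volume g :: (real ^ 'p::finite) \<times> (real ^ 'n::finite) \<Rightarrow> real"
  shows "continuous_on length_domain V"
    and "\<exists>f. hpw 0 (4 * g + CARD('p) + CARD('n) - 3) f \<and> (\<forall>L\<in>length_domain. \<forall>t. V L = f L t)"
proof -
  let ?\<C> = "(four_valent_graphs g :: (nat, 'p, 'n) directed_ribbon_graph set) // iso_rel g"
  let ?d = "4 * g + CARD('p) + CARD('n) - 3"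
  define rep where "rep = (\<lambda>C :: (nat, 'p, 'n) directed_ribbon_graph set. SOME R. R \<in> C)"
  define vol where "vol = (\<lambda>C L. lattice_volume (edges (rep C)) (boundary_kernel (rep C)) (Met (rep C) L))"
  define \<kappa> where "\<kappa> = (\<lambda>C. 1 / real (card (automorphisms (rep C))))"
  have V: "V = (\<lambda>L. \<Sum>C\<in>?\<C>. \<kappa> C * vol C L)"
    unfolding V_def moduli_volume_def rep_def vol_def \<kappa>_def Let_def ..
  have C: "continuous_on length_domain (vol C) \<and>
      (\<exists>f. hpw 0 ?d f \<and> (\<forall>L\<in>length_domain. \<forall>t. vol C L = f L t))" if "C \<in> ?\<C>" for C
  proof -
    interpret four_valent_directed_graph "rep C" g
      unfolding rep_def by (rule four_valent_graphs_representative[OF that])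
    obtain a k b r where k: "k = ?d" and a: "\<And>e. linear (\<lambda>L. a L e)" and r: "linear r"
      and slice: "\<And>L. L \<in> length_domain \<Longrightarrow> vol C L = slice_volume (edges (rep C)) k b (a L)"
      and bound: "\<And>L t i. L \<in> length_domain \<Longrightarrow> t \<in> slice (edges (rep C)) k b (a L) \<Longrightarrow> i < k \<Longrightarrow> \<bar>t i\<bar> < r L"
      and row: "\<And>e L. e \<in> edges (rep C) \<Longrightarrow> L \<in> length_domain \<Longrightarrow> \<forall>i<k. b i e = 0 \<Longrightarrow> a L e > 0"
      unfolding vol_def by (rule lattice_volume_Met) blast
    have "continuous_on length_domain (\<lambda>L. slice_volume (edges (rep C)) k b (a L))"
      by (rule slice_volume_continuous[where r = r]) (rule finite_edges a r | erule (2) bound | erule (2) row)+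
    then have "continuous_on length_domain (vol C)"
      by (rule continuous_on_eq) (simp add: slice)
    moreover have "\<exists>f. hpw 0 k f \<and>
        (\<forall>L\<in>length_domain. \<forall>t. slice_volume (edges (rep C)) k b (a L) = f L t)"
      by (rule slice_volume_hpw[where r = r]) (rule finite_edges a r | erule (2) bound)+
    ultimately show ?thesis using k by (simp add: slice)
  qed
  then show "continuous_on length_domain V"
    unfolding V by (intro continuous_intros) blast
  from C obtain f where f: "\<And>C. C \<in> ?\<C> \<Longrightarrow> hpw 0 ?d (f C)"
    "\<And>C L t. C \<in> ?\<C> \<Longrightarrow> L \<in> length_domain \<Longrightarrow> vol C L = f C L t"
    by metis
  have "hpw 0 ?d (\<lambda>L t. \<Sum>C\<in>?\<C>. \<kappa> C * f C L t)"
    by (intro hpw_sum hpw_scale f)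
  moreover have "\<forall>L\<in>length_domain. \<forall>t. V L = (\<Sum>C\<in>?\<C>. \<kappa> C * f C L t)"
    unfolding V using f(2) by (auto intro!: sum.cong)
  ultimately show "\<exists>f. hpw 0 ?d f \<and> (\<forall>L\<in>length_domain. \<forall>t. V L = f L t)" by blast
qed

lemma piecewise_homogeneous_polynomial_on_cong:
  assumes "piecewise_homogeneous_polynomial_on S H d f" "\<And>x. x \<in> S \<Longrightarrow> f x = h x"
  shows "piecewise_homogeneous_polynomial_on S H d h"
proof -
  obtain \<W> where W: "finite \<W>" "\<forall>W\<in>\<W>. hyperplane_in H W"
    "\<forall>C\<in>components (S - \<Union>\<W>). \<exists>p. homogeneous_polynomial d p \<and> (\<forall>x\<in>C. f x = p x)"
    using assms(1) unfolding piecewise_homogeneous_polynomial_on_def by blast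
  have "\<exists>p. homogeneous_polynomial d p \<and> (\<forall>x\<in>C. h x = p x)" if C: "C \<in> components (S - \<Union>\<W>)" for C
  proof -
    have "C \<subseteq> S" using in_components_subset[OF C] by blast
    then have "\<forall>x\<in>C. f x = h x" using assms(2) by blast
    with W(3) C show ?thesis by fastforce
  qed
  with W(1,2) show ?thesis unfolding piecewise_homogeneous_polynomial_on_def by blast
qed

theorem theorem1:
  fixes g :: nat
    and V :: "(real ^ 'p::finite) \<times> (real ^ 'n::finite) \<Rightarrow> real"
  defines "V \<equiv> moduli_volume g"
    and "d \<equiv> 4 * g + CARD('p) + CARD('n) - 3"
  assumes "2 * int g - 2 + int CARD('p) + int CARD('n) > 0"
  shows "continuous_on length_domain V \<and>
         homogeneous_on length_domain d V \<and>
         piecewise_homogeneous_polynomial_on length_domain length_space d V"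
proof (intro conjI)
  show "continuous_on length_domain V"
    unfolding V_def by (rule moduli_volume_hpw)
  obtain f where f: "hpw 0 d f" and V: "\<And>L t. L \<in> length_domain \<Longrightarrow> V L = f L t"
    using moduli_volume_hpw(2)[where 'p = 'p and 'n = 'n, of g] unfolding V_def d_def by blast
  show "homogeneous_on length_domain d V"
    unfolding homogeneous_on_def
  proof (intro ballI allI impI)
    fix L :: "(real ^ 'p) \<times> (real ^ 'n)" and r :: real
    assume L: "L \<in> length_domain" and r: "r > 0"
    then have "r *\<^sub>R L \<in> length_domain" by (simp add: length_domain_def flip: sum_distrib_left)
    \<comment> \<open>On the domain \<open>f L t\<close> equals \<open>V L\<close> for every
      \<open>t\<close>, so the auxiliary argument may be fixed to the zero function, which scaling
      leaves unchanged.\<close>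
    then show "V (r *\<^sub>R L) = r ^ d * V L"
      using hpw_homogeneous[OF f r, of L "\<lambda>_. 0"] V L by simp
  qed
  have "subspace (length_space :: ((real ^ 'p) \<times> (real ^ 'n)) set)"
    by (simp add: subspace_def length_space_def sum.distrib flip: sum_distrib_left)
  moreover have "length_domain \<subseteq> (length_space :: ((real ^ 'p) \<times> (real ^ 'n)) set)"
    by (auto simp: length_domain_def length_space_def)
  ultimately have "piecewise_homogeneous_polynomial_on length_domain length_space d (\<lambda>L. f L (\<lambda>_. 0))"
    by (rule hpw_0_piecewise[OF f])
  then show "piecewise_homogeneous_polynomial_on length_domain length_space d V"
    by (rule piecewise_homogeneous_polynomial_on_cong) (rule V[symmetric])
qed

end
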